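(* Let $\alpha_0\in(-\pi,\pi)$ and $p=\frac{\pi+|\alpha_0|}{2}$. Then \[G(p)\le\sup\Big\{\Big\|\log\big(\exp(\tfrac{\pi-\alpha}2A)\exp(\tfrac{\pi+\alpha}2B)\big)\Big\|_2:\ |\alpha|\le|\alpha_0|,\ A,B\in M_2(\mathbb R),\ \|A\|_2,\|B\|_2\le1,\ (A,B)\notin\{(\tilde I,\tilde I),(-\tilde I,-\tilde I)\}\Big\}<+\infty,\] where all the logarithms in the set are well-defined.
   Context: $\tilde I=\begin{pmatrix}0&-1\\1&0\end{pmatrix}$; $\|\cdot\|_2$ is the operator norm; $\log$ the principal logarithm. $G(p)=\operatorname{AC}(\cosh(\pi-p)\cos p)\cdot(\sinh(\pi-p)+\cosh(\pi-p)\sin p)$ for $p\in[\pi/2,\pi)$, where $\operatorname{AC}(x)=\frac{\arccos x}{\sqrt{1-x^2}}$ for $-1<x<1$, $\operatorname{AC}(1)=1$, $\operatorname{AC}(x)=\frac{\operatorname{arcosh}x}{\sqrt{x^2-1}}$ for $x>1$. *)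

theory Defs
  imports "HOL-Analysis.Analysis"
begin

type_synonym mat2 = "real^2^2"

definition Itilde :: mat2 where
  "Itilde = vector [vector [0, -1], vector [1, 0]]"

definition opnorm2 :: "mat2 \<Rightarrow> real" where
  "opnorm2 A = onorm (\<lambda>x. A *v x)"

primrec mpow :: "mat2 \<Rightarrow> nat \<Rightarrow> mat2" where
  "mpow A 0 = mat 1"
| "mpow A (Suc n) = A ** mpow A n"

definition mexp :: "mat2 \<Rightarrow> mat2" where
  "mexp A = (\<Sum>n. (1 / fact n) *\<^sub>R mpow A n)"

definition cmat :: "mat2 \<Rightarrow> complex^2^2" where
  "cmat A = (\<chi> i j. complex_of_real (A $ i $ j))"

definition is_eigenvalue2 :: "mat2 \<Rightarrow> complex \<Rightarrow> bool" where
  "is_eigenvalue2 A z \<longleftrightarrow> det (mat z - cmat A) = 0"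

definition is_principal_log :: "mat2 \<Rightarrow> mat2 \<Rightarrow> bool" where
  "is_principal_log L M \<longleftrightarrow>
     mexp L = M \<and> (\<forall>z. is_eigenvalue2 L z \<longrightarrow> - pi < Im z \<and> Im z < pi)"

definition log_welldef :: "mat2 \<Rightarrow> bool" where
  "log_welldef M \<longleftrightarrow> (\<exists>!L. is_principal_log L M)"

definition mlog :: "mat2 \<Rightarrow> mat2" where
  "mlog M = (THE L. is_principal_log L M)"

definition AC :: "real \<Rightarrow> real" where
  "AC x = (if x < 1 then arccos x / sqrt (1 - x\<^sup>2)
           else if x = 1 then 1 else arcosh x / sqrt (x\<^sup>2 - 1))"

definition G :: "real \<Rightarrow> real" where
  "G p = AC (cosh (pi - p) * cos p) * (sinh (pi - p) + cosh (pi - p) * sin p)"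

definition prodset :: "real \<Rightarrow> (real \<times> mat2 \<times> mat2) set" where
  "prodset \<alpha>0 = {(\<alpha>, A, B). \<bar>\<alpha>\<bar> \<le> \<bar>\<alpha>0\<bar> \<and> opnorm2 A \<le> 1 \<and> opnorm2 B \<le> 1
      \<and> (A, B) \<notin> {(Itilde, Itilde), (- Itilde, - Itilde)}}"

definition prodmat :: "real \<Rightarrow> mat2 \<Rightarrow> mat2 \<Rightarrow> mat2" where
  "prodmat \<alpha> A B = mexp (((pi - \<alpha>) / 2) *\<^sub>R A) ** mexp (((pi + \<alpha>) / 2) *\<^sub>R B)"

end

theory Submission
  imports Defs
begin

text \<open>
  Identify the plane with the complex numbers, so that a real matrix acts as
  \<open>z \<mapsto> P z + Q cnj z\<close> and its operator norm is \<open>|P| + |Q|\<close>. Along \<open>x(t) = exp(tA) v\<close> the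
  logarithmic derivative is \<open>x'/x = P + Q (cnj x / x)\<close>, so the direction of \<open>x\<close> turns at speed
  \<open>Im P + |Q| sin(\<theta> - 2 arg x) \<le> 1\<close>. Full speed forces \<open>sin(\<theta> - 2 arg x)\<close> to stay at 1, which
  is impossible for a turning direction unless \<open>Im P = 1\<close>; quantitatively, in time \<open>s\<close> the direction
  turns by at most \<open>s - (1 - Im P)(s - sin s)/3\<close>. Hence the product turns every vector by an
  angle \<open>D\<close> with \<open>|D| \<le> \<pi> - \<kappa> g\<close>, where \<open>g\<close> measures the distance of \<open>(A, B)\<close> from the two
  exceptional pairs. This keeps the spectrum off the negative half-line. Conversely
  \<open>|sin D| \<le> 2 \<pi> g\<close>, so for \<open>M\<close> near \<open>-1\<close> both \<open>|Im P| + |Q|\<close> and \<open>|Im P| - |Q|\<close> are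
  comparable to \<open>g\<close>; since the logarithm has size about
  \<open>\<pi> sqrt((|Im P| + |Q|) / (|Im P| - |Q|))\<close> there, it stays bounded. The value \<open>G(p)\<close> is attained
  at \<open>A = diag(1, -1)\<close>, \<open>B\<close> the rotation generator, \<open>\<alpha> = |\<alpha>0|\<close>.
\<close>

section \<open>Complex coordinates\<close>

text \<open>The coefficient \<open>P\<close> of the action \<open>z \<mapsto> P z + Q cnj z\<close>;
  \<open>anti\<close> below gives \<open>Q\<close>. In these coordinates the rotation generator
  becomes the pair \<open>(\<i>, 0)\<close>.\<close>

definition hol :: "mat2 \<Rightarrow> complex" where
  "hol M = Complex ((M$1$1 + M$2$2) / 2) ((M$2$1 - M$1$2) / 2)"

definition anti :: "mat2 \<Rightarrow> complex" where
  "anti M = Complex ((M$1$1 - M$2$2) / 2) ((M$2$1 + M$1$2) / 2)"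

lemma mat2_eqI:
  assumes "hol M = hol N" "anti M = anti N"
  shows "M = N"
proof -
  have "M$1$1 = N$1$1 \<and> M$1$2 = N$1$2 \<and> M$2$1 = N$2$1 \<and> M$2$2 = N$2$2"
    using assms unfolding hol_def anti_def complex.inject by argo
  then show ?thesis
    by (simp add: vec_eq_iff forall_2)
qed

lemma hol_mult: "hol (M ** N) = hol M * hol N + anti M * cnj (anti N)"
  and anti_mult: "anti (M ** N) = hol M * anti N + anti M * cnj (hol N)"
  by (simp_all add: hol_def anti_def matrix_matrix_mult_def sum_2 complex_eq_iff field_simps)

lemma hol_add: "hol (M + N) = hol M + hol N"
  and anti_add: "anti (M + N) = anti M + anti N"
  and hol_minus: "hol (- M) = - hol M"
  and anti_minus: "anti (- M) = - anti M"
  and hol_scaleR: "hol (r *\<^sub>R M) = of_real r * hol M"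
  and anti_scaleR: "anti (r *\<^sub>R M) = of_real r * anti M"
  and hol_mat: "hol (mat r) = of_real r"
  and anti_mat: "anti (mat r) = 0"
  by (simp_all add: hol_def anti_def complex_eq_iff mat_def field_simps)

lemmas hol_anti_simps = hol_mult anti_mult hol_add anti_add hol_minus anti_minus
  hol_scaleR anti_scaleR hol_mat anti_mat

lemma hol_Itilde: "hol Itilde = \<i>" and anti_Itilde: "anti Itilde = 0"
  by (simp_all add: hol_def anti_def Itilde_def complex_eq_iff vector_2)

definition ofc :: "complex \<Rightarrow> complex \<Rightarrow> mat2" where
  "ofc P Q = vector [vector [Re P + Re Q, Im Q - Im P], vector [Im P + Im Q, Re P - Re Q]]"

lemma hol_ofc [simp]: "hol (ofc P Q) = P" and anti_ofc [simp]: "anti (ofc P Q) = Q"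
  by (simp_all add: hol_def anti_def ofc_def complex_eq_iff vector_2)

text \<open>A quarter of the discriminant of the characteristic polynomial: the eigenvalues of
  \<open>M\<close> are \<open>Re (hol M)\<close> plus or minus a square root of
  \<open>disc M\<close>.\<close>

definition disc :: "mat2 \<Rightarrow> real" where
  "disc M = (cmod (anti M))\<^sup>2 - (Im (hol M))\<^sup>2"

lemma det_hol_anti: "det M = (cmod (hol M))\<^sup>2 - (cmod (anti M))\<^sup>2"
  unfolding cmod_power2 by (simp add: det_2 hol_def anti_def power2_eq_square field_simps)

lemma disc_eq: "disc M = (Re (hol M))\<^sup>2 - det M"
  by (simp add: det_hol_anti disc_def cmod_power2)

text \<open>The trace-free part. Its square is the scalar matrix
  \<open>disc A *\<^sub>R mat 1\<close>, which makes powers and exponentials explicit.\<close>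

definition dev :: "mat2 \<Rightarrow> mat2" where
  "dev A = A - mat (Re (hol A))"

lemma hol_dev: "hol (dev A) = \<i> * Im (hol A)" and anti_dev: "anti (dev A) = anti A"
  by (simp_all add: dev_def hol_def anti_def complex_eq_iff mat_def)

section \<open>The exponential along a ray\<close>

text \<open>The fundamental solutions of \<open>y'' = c y\<close>.\<close>

definition Cf :: "real \<Rightarrow> real \<Rightarrow> real" where
  "Cf c t = (if c > 0 then cosh (sqrt c * t) else if c = 0 then 1 else cos (sqrt (-c) * t))"

definition Sf :: "real \<Rightarrow> real \<Rightarrow> real" where
  "Sf c t = (if c > 0 then sinh (sqrt c * t) / sqrt c else if c = 0 then t
             else sin (sqrt (-c) * t) / sqrt (-c))"

lemma Cf_0 [simp]: "Cf c 0 = 1" and Sf_0 [simp]: "Sf c 0 = 0"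
  by (simp_all add: Cf_def Sf_def)

lemma Cf_deriv: "(Cf c has_real_derivative c * Sf c t) (at t)"
proof -
  consider "c > 0" | "c = 0" | "c < 0" by linarith
  then show ?thesis
  proof cases
    case 1
    then have "Cf c = (\<lambda>t. cosh (sqrt c * t))" by (auto simp: Cf_def)
    moreover have "((\<lambda>t. cosh (sqrt c * t)) has_real_derivative sinh (sqrt c * t) * sqrt c) (at t)"
      by (auto intro!: derivative_eq_intros)
    moreover have "sinh (sqrt c * t) * sqrt c = c * Sf c t"
      using 1 real_div_sqrt[of c] by (simp add: Sf_def field_simps)
    ultimately show ?thesis by simp
  next
    case 2
    then have "Cf c = (\<lambda>t. 1)" by (auto simp: Cf_def)
    with 2 show ?thesis by simp
  next
    case 3
    then have "Cf c = (\<lambda>t. cos (sqrt (-c) * t))" by (auto simp: Cf_def)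
    moreover have "((\<lambda>t. cos (sqrt (-c) * t)) has_real_derivative - sin (sqrt (-c) * t) * sqrt (-c)) (at t)"
      by (auto intro!: derivative_eq_intros)
    moreover have "- sin (sqrt (-c) * t) * sqrt (-c) = c * Sf c t"
    proof -
      define w where "w = sqrt (-c)"
      have w: "w > 0" "c = - (w * w)" using 3 by (simp_all add: w_def)
      have "Sf c t = sin (w * t) / w" using 3 by (simp add: Sf_def w_def)
      then have "c * Sf c t = - (w * w) * (sin (w * t) / w)" by (simp only: w(2)[symmetric])
      also have "\<dots> = - sin (w * t) * w" using w(1) by simp
      finally show ?thesis by (simp add: w_def)
    qed
    ultimately show ?thesis by simp
  qed
qed

lemma Sf_deriv: "(Sf c has_real_derivative Cf c t) (at t)"
proof -
  consider "c > 0" | "c = 0" | "c < 0" by linarith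
  then show ?thesis
  proof cases
    case 1
    then have "Sf c = (\<lambda>t. sinh (sqrt c * t) / sqrt c)" by (auto simp: Sf_def)
    moreover have "((\<lambda>t. sinh (sqrt c * t) / sqrt c) has_real_derivative cosh (sqrt c * t) * sqrt c / sqrt c) (at t)"
      by (intro DERIV_cdivide) (auto intro!: derivative_eq_intros)
    ultimately show ?thesis using 1 by (simp add: Cf_def)
  next
    case 2
    then have "Sf c = (\<lambda>t. t)" by (auto simp: Sf_def)
    with 2 show ?thesis by (simp add: Cf_def)
  next
    case 3
    then have "Sf c = (\<lambda>t. sin (sqrt (-c) * t) / sqrt (-c))" by (auto simp: Sf_def)
    moreover have "((\<lambda>t. sin (sqrt (-c) * t) / sqrt (-c)) has_real_derivative cos (sqrt (-c) * t) * sqrt (-c) / sqrt (-c)) (at t)"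
      by (intro DERIV_cdivide) (auto intro!: derivative_eq_intros)
    ultimately show ?thesis using 3 by (simp add: Cf_def)
  qed
qed

text \<open>For \<open>c = disc A\<close> the left side is the determinant of
  \<open>Cf c t *\<^sub>R mat 1 + Sf c t *\<^sub>R dev A\<close>.\<close>

lemma Cf_Sf_pythagoras: "(Cf c t)\<^sup>2 - c * (Sf c t)\<^sup>2 = 1"
proof -
  consider "c > 0" | "c = 0" | "c < 0" by linarith
  then show ?thesis
  proof cases
    case 1
    then show ?thesis
      by (simp add: Cf_def Sf_def power_divide cosh_square_eq)
  next
    case 2
    then show ?thesis by (simp add: Cf_def)
  next
    case 3
    then show ?thesis
      by (simp add: Cf_def Sf_def power_divide)
  qed
qed

section \<open>Summing the exponential series\<close>

lemma mpow_scaleR: "mpow (t *\<^sub>R A) n = t ^ n *\<^sub>R mpow A n"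
  by (induction n)
     (simp_all add: mat2_eqI hol_anti_simps mult_ac ring_distribs)

lemma mexp_scaleR_series:
  fixes p q :: "nat \<Rightarrow> real"
  assumes pow: "\<And>n. mpow A n = p n *\<^sub>R mat 1 + q n *\<^sub>R dev A"
    and p: "(\<lambda>n. t ^ n / fact n * p n) sums x"
    and q: "(\<lambda>n. t ^ n / fact n * q n) sums y"
  shows "mexp (t *\<^sub>R A) = x *\<^sub>R mat 1 + y *\<^sub>R dev A"
proof -
  have "(\<lambda>n. (t ^ n / fact n * p n) *\<^sub>R mat 1 + (t ^ n / fact n * q n) *\<^sub>R dev A)
          sums (x *\<^sub>R mat 1 + y *\<^sub>R dev A)"
    by (intro sums_add sums_scaleR_left p q)
  moreover have "(1 / fact n) *\<^sub>R mpow (t *\<^sub>R A) n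
      = (t ^ n / fact n * p n) *\<^sub>R mat 1 + (t ^ n / fact n * q n) *\<^sub>R dev A" for n
    by (simp add: mpow_scaleR pow scaleR_add_right)
  ultimately show ?thesis
    unfolding mexp_def by (simp add: sums_iff)
qed

text \<open>Since \<open>A\<close> is \<open>Re (hol A) *\<^sub>R mat 1 + dev A\<close> and
  \<open>dev A\<close> squares to a scalar, multiplication by \<open>A\<close> preserves the span of
  \<open>mat 1\<close> and \<open>dev A\<close> and acts on the coefficients by this recursion. A
  closed form for the powers then needs only a scalar check.\<close>

lemma mpow_recurrence:
  assumes "p 0 = 1" "q 0 = 0"
    and "\<And>n. p (Suc n) = Re (hol A) * p n + disc A * q n"
    and "\<And>n. q (Suc n) = p n + Re (hol A) * q n"
  shows "mpow A n = p n *\<^sub>R mat 1 + q n *\<^sub>R dev A"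
proof (induction n)
  case 0
  then show ?case using assms by simp
next
  case (Suc n)
  have "mpow A (Suc n) = A ** (p n *\<^sub>R mat 1 + q n *\<^sub>R dev A)"
    using Suc by simp
  also have "\<dots> = p (Suc n) *\<^sub>R mat 1 + q (Suc n) *\<^sub>R dev A"
    by (rule mat2_eqI; simp only: hol_anti_simps hol_dev anti_dev assms disc_def complex_eq_iff cmod_power2;
        simp; simp add: power2_eq_square algebra_simps)
  finally show ?case .
qed

lemma mexp_ray:
  "mexp (t *\<^sub>R A) = exp (t * Re (hol A)) *\<^sub>R (Cf (disc A) t *\<^sub>R mat 1 + Sf (disc A) t *\<^sub>R dev A)"
proof -
  define l c where "l = Re (hol A)" and "c = disc A"
  have *: "(\<lambda>n. t ^ n / fact n * z ^ n) sums exp (t * z)" for z :: real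
    using exp_converges[of "t * z"] by (simp add: power_mult_distrib divide_inverse mult_ac)
  consider "c > 0" | "c = 0" | "c < 0" by linarith
  then have "mexp (t *\<^sub>R A) = (exp (t * l) * Cf c t) *\<^sub>R mat 1 + (exp (t * l) * Sf c t) *\<^sub>R dev A"
  proof cases
    case 1
    define w where "w = sqrt c"
    have w: "w > 0" "c = w * w" using 1 by (simp_all add: w_def)
    show ?thesis
    proof (rule mexp_scaleR_series)
      \<comment> \<open>Two real eigenvalues, \<open>l + w\<close> and \<open>l - w\<close>.\<close>
      show "mpow A n = (((l + w) ^ n + (l - w) ^ n) / 2) *\<^sub>R mat 1
          + (((l + w) ^ n - (l - w) ^ n) / (2 * w)) *\<^sub>R dev A" for n
        by (rule mpow_recurrence) (use w in \<open>simp_all add: field_simps flip: l_def c_def\<close>)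
      have "(\<lambda>n. (t ^ n / fact n * (l + w) ^ n + t ^ n / fact n * (l - w) ^ n) / 2)
          sums ((exp (t * (l + w)) + exp (t * (l - w))) / 2)"
        by (intro sums_divide sums_add *)
      moreover have "(exp (t * (l + w)) + exp (t * (l - w))) / 2 = exp (t * l) * Cf c t"
        using 1 by (simp add: Cf_def cosh_def w_def ring_distribs mult_ac exp_add exp_diff exp_minus field_simps)
      ultimately show "(\<lambda>n. t ^ n / fact n * (((l + w) ^ n + (l - w) ^ n) / 2)) sums (exp (t * l) * Cf c t)"
        by (simp add: ring_distribs)
      have "(\<lambda>n. (t ^ n / fact n * (l + w) ^ n - t ^ n / fact n * (l - w) ^ n) / (2 * w))
          sums ((exp (t * (l + w)) - exp (t * (l - w))) / (2 * w))"
        by (intro sums_divide sums_diff *)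
      moreover have "(exp (t * (l + w)) - exp (t * (l - w))) / (2 * w) = exp (t * l) * Sf c t"
        using 1 by (simp add: Sf_def sinh_def w_def ring_distribs mult_ac exp_add exp_diff exp_minus field_simps)
      ultimately show "(\<lambda>n. t ^ n / fact n * (((l + w) ^ n - (l - w) ^ n) / (2 * w))) sums (exp (t * l) * Sf c t)"
        by (simp add: ring_distribs)
    qed
  next
    case 2
    show ?thesis
    proof (rule mexp_scaleR_series)
      \<comment> \<open>Double eigenvalue: the limit of the previous formula as \<open>w\<close>
        tends to 0. At \<open>n = 0\<close> the truncated \<open>n - 1\<close> is harmless because
        of the factor \<open>of_nat n\<close>.\<close>
      show "mpow A n = l ^ n *\<^sub>R mat 1 + (of_nat n * l ^ (n - 1)) *\<^sub>R dev A" for n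
        by (rule mpow_recurrence)
           (use 2 in \<open>simp_all add: algebra_simps power_eq_if flip: l_def c_def\<close>)
      show "(\<lambda>n. t ^ n / fact n * l ^ n) sums (exp (t * l) * Cf c t)"
        using *[of l] 2 by (simp add: Cf_def)
      have "(\<lambda>n. t * (t ^ n / fact n * l ^ n)) sums (t * exp (t * l))"
        by (intro sums_mult *)
      then have "(\<lambda>n. t ^ Suc n / fact (Suc n) * (of_nat (Suc n) * l ^ (Suc n - 1))) sums (t * exp (t * l))"
        by (simp add: field_simps del: of_nat_Suc)
      \<comment> \<open>The term at index 0 vanishes, so shifting the index does not change the
        sum.\<close>
      then show "(\<lambda>n. t ^ n / fact n * (of_nat n * l ^ (n - 1))) sums (exp (t * l) * Sf c t)"
        using 2 by (subst (asm) sums_Suc_iff) (simp add: Sf_def mult_ac)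
    qed
  next
    case 3
    define w where "w = sqrt (-c)"
    have w: "w > 0" "c = - (w * w)" using 3 by (simp_all add: w_def)
    have E: "(\<lambda>n. t ^ n / fact n * Re (Complex l w ^ n)) sums (exp (t * l) * cos (t * w))"
            "(\<lambda>n. t ^ n / fact n * Im (Complex l w ^ n)) sums (exp (t * l) * sin (t * w))"
    proof -
      have "(\<lambda>n. (t ^ n / fact n) *\<^sub>R Complex l w ^ n) sums exp (t *\<^sub>R Complex l w)"
        using exp_converges[of "t *\<^sub>R Complex l w"]
        by (simp add: scaleR_power divide_inverse mult_ac)
      from sums_Re[OF this] sums_Im[OF this]
      show "(\<lambda>n. t ^ n / fact n * Re (Complex l w ^ n)) sums (exp (t * l) * cos (t * w))"
            "(\<lambda>n. t ^ n / fact n * Im (Complex l w ^ n)) sums (exp (t * l) * sin (t * w))"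
        by (simp_all add: Re_exp Im_exp)
    qed
    show ?thesis
    proof (rule mexp_scaleR_series)
      \<comment> \<open>Conjugate eigenvalues \<open>l + \<i> w\<close> and
        \<open>l - \<i> w\<close>: the half sum and half difference of their powers are real and
        imaginary parts.\<close>
      show "mpow A n = Re (Complex l w ^ n) *\<^sub>R mat 1 + (Im (Complex l w ^ n) / w) *\<^sub>R dev A" for n
        by (rule mpow_recurrence) (use w in \<open>simp_all add: field_simps flip: l_def c_def\<close>)
      show "(\<lambda>n. t ^ n / fact n * Re (Complex l w ^ n)) sums (exp (t * l) * Cf c t)"
        using E(1) 3 by (simp add: Cf_def w_def mult_ac)
      have "exp (t * l) * sin (t * w) / w = exp (t * l) * Sf c t"
        using 3 by (simp add: Sf_def w_def mult_ac)
      then show "(\<lambda>n. t ^ n / fact n * (Im (Complex l w ^ n) / w)) sums (exp (t * l) * Sf c t)"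
        using sums_divide[OF E(2), of w] by simp
    qed
  qed
  then show ?thesis by (simp add: l_def c_def scaleR_add_right)
qed

lemma hol_mexp: "hol (mexp (t *\<^sub>R A)) =
    of_real (exp (t * Re (hol A))) * (of_real (Cf (disc A) t) + of_real (Sf (disc A) t) * (\<i> * Im (hol A)))"
  and anti_mexp: "anti (mexp (t *\<^sub>R A)) =
    of_real (exp (t * Re (hol A))) * (of_real (Sf (disc A) t) * anti A)"
  by (simp_all add: mexp_ray hol_anti_simps hol_dev anti_dev)

lemma det_mexp: "det (mexp (t *\<^sub>R A)) = exp (t * Re (hol A)) ^ 2"
proof -
  have "det (mexp (t *\<^sub>R A)) = exp (t * Re (hol A)) ^ 2 * ((Cf (disc A) t)\<^sup>2 - disc A * (Sf (disc A) t)\<^sup>2)"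
    by (simp add: det_hol_anti hol_mexp anti_mexp norm_mult power_mult_distrib cmod_power2 disc_def algebra_simps)
  then show ?thesis by (simp add: Cf_Sf_pythagoras)
qed

section \<open>Elementary inequalities and the function AC\<close>

lemma mult_cos_le_sin:
  fixes x :: real
  assumes "0 \<le> x" "x \<le> pi"
  shows "x * cos x \<le> sin x"
proof -
  have "(\<lambda>x. sin x - x * cos x) 0 \<le> (\<lambda>x. sin x - x * cos x) x"
  proof (rule DERIV_nonneg_imp_nondecreasing[OF assms(1)])
    fix y assume "0 \<le> y" "y \<le> x"
    then show "\<exists>d. ((\<lambda>x. sin x - x * cos x) has_real_derivative d) (at y) \<and> 0 \<le> d"
      using assms by (intro exI[of _ "y * sin y"]) (auto intro!: derivative_eq_intros simp: sin_ge_zero)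
  qed
  then show ?thesis by simp
qed

text \<open>By the half-angle formulas, \<open>sin x = 2 sin (x/2) cos (x/2)\<close> is at least
  \<open>x (cos (x/2))\<^sup>2 = (x/2) (1 + cos x)\<close>.\<close>

lemma half_le_sin:
  fixes x :: real
  assumes "0 \<le> x" "x \<le> pi / 2"
  shows "x / 2 \<le> sin x"
proof -
  have c: "0 \<le> cos (x/2)" "0 \<le> cos x" using assms by (auto intro!: cos_ge_zero)
  have "x / 2 \<le> x / 2 * (1 + cos x)"
    using assms c by (simp add: algebra_simps)
  also have "\<dots> = (x / 2 * cos (x / 2)) * (2 * cos (x / 2))"
    using cos_double_cos[of "x/2"] by (simp add: power2_eq_square)
  also have "\<dots> \<le> sin (x / 2) * (2 * cos (x / 2))"
    using assms c by (intro mult_right_mono mult_cos_le_sin) auto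
  also have "\<dots> = sin x"
    using sin_double[of "x/2"] by simp
  finally show ?thesis .
qed

text \<open>Strictness is what later makes the turning margin \<open>\<kappa>\<close>
  positive.\<close>

lemma sin_less_self:
  fixes x :: real
  assumes "0 < x" "x < pi"
  shows "sin x < x"
proof -
  have "sin (x / 2) > 0" "cos (x / 2) < cos 0"
    using assms by (auto intro: sin_gt_zero cos_monotone_0_pi simp del: cos_zero)
  then have "2 * (sin (x / 2) * cos (x / 2)) < 2 * sin (x / 2)" by simp
  then have "sin x < 2 * sin (x / 2)" using sin_double[of "x / 2"] by simp
  also have "\<dots> \<le> x" using sin_x_le_x[of "x / 2"] assms by simp
  finally show ?thesis .
qed

lemma le_sinh:
  fixes x :: real
  assumes "0 \<le> x"
  shows "x \<le> sinh x"
proof -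
  have "(\<lambda>x. sinh x - x) 0 \<le> (\<lambda>x. sinh x - x) x"
  proof (rule DERIV_nonneg_imp_nondecreasing[OF assms(1)])
    fix y :: real
    show "\<exists>d. ((\<lambda>x. sinh x - x) has_real_derivative d) (at y) \<and> 0 \<le> d"
      by (intro exI[of _ "cosh y - 1"]) (auto intro!: derivative_eq_intros simp: cosh_real_ge_1)
  qed
  then show ?thesis by simp
qed

section \<open>Bounds on \<open>AC\<close> and its link with \<open>Cf\<close> and
  \<open>Sf\<close>\<close>

lemma AC_pos:
  assumes "x > -1"
  shows "AC x > 0"
proof -
  consider "x < 1" | "x = 1" | "x > 1" by linarith
  then show ?thesis
  proof cases
    case 1
    then have "x\<^sup>2 < 1" using assms by (simp add: abs_square_less_1)
    then show ?thesis using 1 assms arccos_lt_bounded[of x] by (simp add: AC_def)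
  next
    case 2 then show ?thesis by (simp add: AC_def)
  next
    case 3
    then have "1 < x\<^sup>2" by (simp add: one_less_power)
    then show ?thesis using 3 arcosh_real_gt_1_iff[of x] by (simp add: AC_def)
  qed
qed

text \<open>With \<open>x = cos y\<close> the value is \<open>y / sin y\<close> on the first
  quadrant; with \<open>x = cosh y\<close> it is \<open>y / sinh y\<close>, even at most 1.\<close>

lemma AC_le_2:
  assumes "0 \<le> x"
  shows "AC x \<le> 2"
proof -
  consider "x < 1" | "x = 1" | "x > 1" by linarith
  then show ?thesis
  proof cases
    case 1
    then have "x\<^sup>2 < 1" using assms by (simp add: abs_square_less_1)
    moreover have "arccos x / 2 \<le> sin (arccos x)"
      using 1 assms by (intro half_le_sin arccos_lbound arccos_le_pi2) auto
    ultimately show ?thesis using 1 assms by (simp add: AC_def sin_arccos divide_le_eq)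
  next
    case 2 then show ?thesis by (simp add: AC_def)
  next
    case 3
    then have "1 < x\<^sup>2" by (simp add: one_less_power)
    then have "sqrt (x\<^sup>2 - 1) > 0" by simp
    moreover have "arcosh x \<le> sqrt (x\<^sup>2 - 1)"
      using 3 le_sinh[of "arcosh x"] by (simp add: sinh_arcosh_real)
    ultimately have "arcosh x / sqrt (x\<^sup>2 - 1) \<le> 1" by simp
    then have "arcosh x / sqrt (x\<^sup>2 - 1) \<le> 2" by linarith
    moreover have "AC x = arcosh x / sqrt (x\<^sup>2 - 1)" using 3 by (simp add: AC_def)
    ultimately show ?thesis by simp
  qed
qed

text \<open>Controls the blow-up of \<open>AC\<close> as \<open>x\<close> approaches
  \<open>-1\<close>.\<close>

lemma AC_le_pi:
  assumes "-1 < x" "x < 1"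
  shows "AC x \<le> pi / sqrt (1 - x\<^sup>2)"
proof -
  have "x\<^sup>2 < 1" using assms by (simp add: abs_square_less_1)
  then show ?thesis using assms arccos_ubound[of x] by (simp add: AC_def divide_right_mono)
qed

text \<open>The hypothesis keeps \<open>sqrt (-c)\<close> below \<open>pi\<close>, the first
  positive zero of the sine.\<close>

lemma Sf_pos: "c > - (pi\<^sup>2) \<Longrightarrow> Sf c 1 > 0"
proof -
  assume c: "c > - (pi\<^sup>2)"
  have "sqrt (-c) < pi" if "c < 0"
    using c that by (intro real_less_lsqrt) auto
  then show ?thesis
    by (auto simp: Sf_def intro!: divide_pos_pos sin_gt_zero)
qed

text \<open>This is the role of \<open>AC\<close> in the logarithm: the trace of an exponential
  gives \<open>Cf c 1\<close>, and \<open>AC\<close> turns it into the factor that undoes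
  \<open>Sf c 1\<close>, uniformly in the sign of \<open>c\<close>.\<close>

lemma AC_Cf:
  assumes c: "c > - (pi\<^sup>2)"
  shows "AC (Cf c 1) = 1 / Sf c 1"
proof -
  consider "c > 0" | "c = 0" | "c < 0" by linarith
  then show ?thesis
  proof cases
    case 1
    then have "cosh (sqrt c) \<noteq> 1" "cosh (sqrt c) \<ge> 1" by (auto simp: cosh_real_ge_1)
    moreover have "sqrt ((cosh (sqrt c))\<^sup>2 - 1) = sinh (sqrt c)"
      using 1 by (simp add: cosh_square_eq)
    ultimately show ?thesis
      using 1 by (simp add: AC_def Cf_def Sf_def arcosh_cosh_real)
  next
    case 2
    then show ?thesis by (simp add: AC_def Cf_def Sf_def)
  next
    case 3
    define w where "w = sqrt (-c)"
    have w: "0 < w" "w < pi" using 3 c by (auto simp: w_def intro!: real_less_lsqrt)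
    then have s: "sin w > 0" by (rule sin_gt_zero)
    have "cos w < 1" using w cos_monotone_0_pi[of 0 w] by simp
    moreover have "sqrt (1 - (cos w)\<^sup>2) = sin w"
      using s by (simp add: flip: sin_squared_eq)
    ultimately show ?thesis
      using 3 w by (simp add: AC_def Cf_def Sf_def arccos_cos flip: w_def)
  qed
qed

lemma Cf_surj:
  assumes "x > -1"
  obtains c where "c > - (pi\<^sup>2)" "Cf c 1 = x"
proof -
  consider "x > 1" | "x = 1" | "x < 1" by linarith
  then show thesis
  proof cases
    case 1
    have "Cf ((arcosh x)\<^sup>2) 1 = x"
      using 1 arcosh_real_gt_1_iff[of x] by (simp add: Cf_def real_sqrt_abs)
    moreover have "- (pi\<^sup>2) < (arcosh x)\<^sup>2"
      by (smt (verit) pi_gt_zero zero_le_power2 zero_less_power)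
    ultimately show ?thesis using that by blast
  next
    case 2
    then show ?thesis using that[of 0] by (simp add: Cf_def)
  next
    case 3
    have a: "0 < arccos x" "arccos x < pi" using assms 3 arccos_lt_bounded[of x] by auto
    have "- (pi\<^sup>2) < - ((arccos x)\<^sup>2)"
      using a by (simp add: power_strict_mono)
    moreover have "Cf (- ((arccos x)\<^sup>2)) 1 = x"
      using a assms 3 by (simp add: Cf_def)
    ultimately show ?thesis using that by blast
  qed
qed

section \<open>Principal logarithms\<close>

lemma is_eigenvalue2_iff: "is_eigenvalue2 L z \<longleftrightarrow> (z - of_real (Re (hol L)))\<^sup>2 = of_real (disc L)"
proof -
  have "det (mat z - cmat L) = (z - of_real (Re (hol L)))\<^sup>2 - of_real (disc L)"
    unfolding disc_eq
    by (simp add: det_2 cmat_def mat_def hol_def power2_eq_square field_simps)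
  then show ?thesis by (simp add: is_eigenvalue2_def)
qed

text \<open>A non-real eigenvalue has imaginary part plus or minus \<open>sqrt (- disc L)\<close>,
  and real eigenvalues impose nothing.\<close>

lemma eigenvalue_strip_iff:
  "(\<forall>z. is_eigenvalue2 L z \<longrightarrow> - pi < Im z \<and> Im z < pi) \<longleftrightarrow> disc L > - (pi\<^sup>2)"
proof
  assume R: "\<forall>z. is_eigenvalue2 L z \<longrightarrow> - pi < Im z \<and> Im z < pi"
  show "disc L > - (pi\<^sup>2)"
  proof (rule ccontr)
    assume "\<not> ?thesis"
    then have le: "pi\<^sup>2 \<le> - disc L" by simp
    define z where "z = Complex (Re (hol L)) (sqrt (- disc L))"
    have "- disc L \<ge> 0" using le by (smt (verit) zero_le_power2)
    then have "is_eigenvalue2 L z"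
      by (simp add: is_eigenvalue2_iff z_def complex_eq_iff power2_eq_square)
    moreover have "pi \<le> Im z" using le by (simp add: z_def real_le_rsqrt)
    ultimately show False using R by force
  qed
next
  assume d: "disc L > - (pi\<^sup>2)"
  show "\<forall>z. is_eigenvalue2 L z \<longrightarrow> - pi < Im z \<and> Im z < pi"
  proof (intro allI impI)
    fix z assume "is_eigenvalue2 L z"
    then have e: "(Re z - Re (hol L))\<^sup>2 - (Im z)\<^sup>2 = disc L" "(Re z - Re (hol L)) * Im z = 0"
      by (auto simp: is_eigenvalue2_iff complex_eq_iff power2_eq_square)
    have "\<bar>Im z\<bar> < pi"
    proof (cases "Im z = 0")
      case False
      then have "(Im z)\<^sup>2 < pi\<^sup>2" using e d by auto
      then show ?thesis using abs_le_square_iff[of pi "Im z"] by (simp add: not_le[symmetric])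
    qed simp
    then show "- pi < Im z \<and> Im z < pi" by linarith
  qed
qed

text \<open>The equation \<open>exp L = exp l (Cf c 1 + Sf c 1 dev L)\<close> solved for
  \<open>L\<close>: \<open>sqrt (det M)\<close> is \<open>exp l\<close>, the normalised half trace
  is \<open>Cf c 1\<close>, and \<open>AC\<close> of it is \<open>1 / Sf c 1\<close>.\<close>

definition nlog :: "mat2 \<Rightarrow> mat2" where
  "nlog M = ofc (Complex (ln (det M) / 2) (AC (Re (hol M) / sqrt (det M)) / sqrt (det M) * Im (hol M)))
     (of_real (AC (Re (hol M) / sqrt (det M)) / sqrt (det M)) * anti M)"

lemma log_unique:
  assumes "is_principal_log L M"
  shows "L = nlog M"
proof -
  define l c where "l = Re (hol L)" and "c = disc L"
  have M: "M = mexp (1 *\<^sub>R L)" and c: "c > - (pi\<^sup>2)"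
    using assms by (auto simp: is_principal_log_def c_def eigenvalue_strip_iff)
  have det: "det M = exp l ^ 2" using det_mexp[of 1 L] by (simp add: M l_def)
  then have sq: "sqrt (det M) = exp l" by simp
  have ln: "ln (det M) / 2 = l" by (simp add: det ln_realpow)
  have P: "hol M = of_real (exp l) * (of_real (Cf c 1) + of_real (Sf c 1) * (\<i> * Im (hol L)))"
    and Q: "anti M = of_real (exp l) * (of_real (Sf c 1) * anti L)"
    using hol_mexp[of 1 L] anti_mexp[of 1 L] by (simp_all add: M l_def c_def)
  have "Re (hol M) / sqrt (det M) = Cf c 1" by (simp add: P sq)
  then have AC: "AC (Re (hol M) / sqrt (det M)) / sqrt (det M) = 1 / (Sf c 1 * exp l)"
    using AC_Cf[OF c] sq by simp
  have S: "Sf c 1 \<noteq> 0" using Sf_pos[OF c] by simp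
  show ?thesis
  proof (rule mat2_eqI)
    show "hol L = hol (nlog M)"
      using S unfolding nlog_def AC ln hol_ofc by (simp add: P complex_eq_iff l_def)
    show "anti L = anti (nlog M)"
      using S unfolding nlog_def AC ln anti_ofc by (simp add: Q)
  qed
qed

text \<open>Any \<open>c\<close> with the right value of \<open>Cf c 1\<close> serves: the scaling
  in \<open>nlog\<close> and the identity \<open>Cf_Sf_pythagoras\<close> force
  \<open>disc (nlog M) = c\<close>, after which the explicit exponential returns
  \<open>M\<close>.\<close>

lemma log_exists:
  assumes d: "det M > 0" and x: "Re (hol M) / sqrt (det M) > -1"
  shows "is_principal_log (nlog M) M"
proof -
  obtain c where c: "c > - (pi\<^sup>2)" "Cf c 1 = Re (hol M) / sqrt (det M)"
    by (rule Cf_surj[OF x])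
  define D where "D = sqrt (det M)"
  have D: "D > 0" "D\<^sup>2 = det M" using d by (simp_all add: D_def)
  have S: "Sf c 1 > 0" using Sf_pos[OF c(1)] .
  have AC: "AC (Re (hol M) / D) / D = 1 / (Sf c 1 * D)"
    using AC_Cf[OF c(1)] c(2) D by (simp add: D_def)
  have N: "hol (nlog M) = Complex (ln (det M) / 2) (1 / (Sf c 1 * D) * Im (hol M))"
     "anti (nlog M) = of_real (1 / (Sf c 1 * D)) * anti M"
    unfolding nlog_def hol_ofc anti_ofc using AC by (simp_all add: D_def)
  have "disc (nlog M) = (1 / (Sf c 1 * D))\<^sup>2 * disc M"
    unfolding disc_def N by (simp add: norm_mult norm_divide power_mult_distrib power_divide diff_divide_distrib)
  also have "disc M = D\<^sup>2 * ((Cf c 1)\<^sup>2 - 1)"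
  proof -
    have "Re (hol M) = Cf c 1 * D" using c(2) D by (simp add: D_def)
    then show ?thesis by (simp add: disc_eq power_mult_distrib algebra_simps flip: D(2))
  qed
  also have "(Cf c 1)\<^sup>2 - 1 = c * (Sf c 1)\<^sup>2"
    using Cf_Sf_pythagoras[of c 1] by simp
  finally have disc: "disc (nlog M) = c"
    using S D d by (auto simp: power_divide power_mult_distrib)
  have e: "exp (Re (hol (nlog M))) = D"
    using d by (simp add: N D_def ln_sqrt[symmetric])
  have "mexp (1 *\<^sub>R nlog M) = M"
  proof (rule mat2_eqI)
    show "hol (mexp (1 *\<^sub>R nlog M)) = hol M"
      unfolding hol_mexp mult_1 e disc using S D c(2) by (simp add: N complex_eq_iff D_def)
    show "anti (mexp (1 *\<^sub>R nlog M)) = anti M"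
      unfolding anti_mexp mult_1 e disc using S D by (simp add: N)
  qed
  then show ?thesis
    by (simp add: is_principal_log_def eigenvalue_strip_iff disc c)
qed

lemma
  assumes "det M > 0" and "Re (hol M) / sqrt (det M) > -1"
  shows log_welldefI: "log_welldef M" and mlog_eq: "mlog M = nlog M"
proof -
  have iff: "is_principal_log L M \<longleftrightarrow> L = nlog M" for L
    using log_exists[OF assms] log_unique by blast
  show "log_welldef M" "mlog M = nlog M"
    unfolding log_welldef_def mlog_def iff by simp_all
qed

section \<open>The operator norm\<close>

definition vec_complex :: "complex \<Rightarrow> real^2" where
  "vec_complex z = vector [Re z, Im z]"

lemma norm_vec_complex: "norm (vec_complex z) = cmod z"
  by (simp add: vec_complex_def norm_vec_def L2_set_def sum_2 vector_2 cmod_def)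

lemma mult_vec_complex: "A *v vec_complex z = vec_complex (hol A * z + anti A * cnj z)"
  by (simp add: vec_complex_def vec_eq_iff forall_2 matrix_vector_mult_def sum_2 vector_2 hol_def anti_def field_simps)

lemma vec_complex_surj: obtains z where "x = vec_complex z"
  by (rule that[of "Complex (x$1) (x$2)"]) (simp add: vec_complex_def vec_eq_iff forall_2)

lemma opnorm2_eq: "opnorm2 A = cmod (hol A) + cmod (anti A)"
proof (rule antisym)
  show "opnorm2 A \<le> cmod (hol A) + cmod (anti A)"
    unfolding opnorm2_def
  proof (rule onorm_bound)
    fix x
    obtain z where "x = vec_complex z" by (rule vec_complex_surj)
    then show "norm (A *v x) \<le> (cmod (hol A) + cmod (anti A)) * norm x"
      using norm_triangle_ineq[of "hol A * z" "anti A * cnj z"]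
      by (simp add: mult_vec_complex norm_vec_complex norm_mult distrib_right)
  qed simp
next
  \<comment> \<open>This direction makes \<open>hol A * z\<close> and \<open>anti A * cnj z\<close>
    parallel, both along \<open>w\<close>, so the triangle inequality is an equality.\<close>
  define z where "z = cis ((Arg (anti A) - Arg (hol A)) / 2)"
  define w where "w = cis ((Arg (anti A) + Arg (hol A)) / 2)"
  have "hol A * z = of_real (cmod (hol A)) * w"
    by (subst (1) rcis_cmod_Arg[of "hol A", symmetric])
       (simp add: z_def w_def rcis_def cis_mult field_simps)
  moreover have "anti A * cnj z = of_real (cmod (anti A)) * w"
    by (subst (1) rcis_cmod_Arg[of "anti A", symmetric])
       (simp add: z_def w_def rcis_def cis_mult cis_cnj field_simps)
  ultimately have "hol A * z + anti A * cnj z = of_real (cmod (hol A) + cmod (anti A)) * w"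
    by (simp add: ring_distribs)
  then have "cmod (hol A * z + anti A * cnj z) = cmod (hol A) + cmod (anti A)"
    by (simp add: norm_mult w_def del: of_real_add)
  moreover have "norm (A *v vec_complex z) \<le> onorm ((*v) A) * norm (vec_complex z)"
    by (rule onorm) simp
  ultimately show "cmod (hol A) + cmod (anti A) \<le> opnorm2 A"
    by (simp add: opnorm2_def mult_vec_complex norm_vec_complex z_def)
qed

section \<open>Turning angles\<close>

text \<open>The lag \<open>J\<close> behind unit speed is bounded below. Integrating a nonnegative
  expression gives about \<open>(1 - b) s\<close>, up to a boundary term in cosines; that term is at
  most \<open>r (sin s + J)\<close>, because a small lag means \<open>\<phi> s\<close> is close to
  \<open>s\<close>.\<close>

lemma scalar_angle_bound:
  fixes \<phi> :: "real \<Rightarrow> real"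
  assumes d: "\<And>x. 0 \<le> x \<Longrightarrow> x \<le> s \<Longrightarrow> (\<phi> has_real_derivative b + r * sin (\<theta> - 2 * \<phi> x)) (at x)"
    and "\<phi> 0 = 0" and s: "0 \<le> s" "s \<le> pi" and r: "0 \<le> r" "\<bar>b\<bar> + r \<le> 1"
  shows "\<phi> s \<le> s - (1 - b) * (s - sin s) / 3"
proof -
  define J where "J = s - \<phi> s"
  have "(\<lambda>x. x - \<phi> x) 0 \<le> (\<lambda>x. x - \<phi> x) s"
  proof (rule DERIV_nonneg_imp_nondecreasing[OF s(1)])
    fix x assume x: "0 \<le> x" "x \<le> s"
    have "r * sin (\<theta> - 2 * \<phi> x) \<le> r * 1" by (rule mult_left_mono) (use r in auto)
    then have "0 \<le> 1 - (b + r * sin (\<theta> - 2 * \<phi> x))" using r by argo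
    then show "\<exists>y. ((\<lambda>x. x - \<phi> x) has_real_derivative y) (at x) \<and> 0 \<le> y"
      by (intro exI[of _ "1 - (b + r * sin (\<theta> - 2 * \<phi> x))"]) (auto intro!: derivative_eq_intros d x)
  qed
  then have J0: "J \<ge> 0" using assms by (simp add: J_def)
  \<comment> \<open>With \<open>q = 1 - \<phi>'\<close> and \<open>S = sin (\<theta> - 2\<phi>)\<close>, the derivative of \<open>?F\<close> is \<open>r q (1 - S)\<close>.\<close>
  let ?F = "\<lambda>x. (1 + r) * (x - \<phi> x) - (1 - b) * x + r * cos (\<theta> - 2 * \<phi> x) / 2"
  have "?F 0 \<le> ?F s"
  proof (rule DERIV_nonneg_imp_nondecreasing[OF s(1)])
    fix x assume x: "0 \<le> x" "x \<le> s"
    define S where "S = sin (\<theta> - 2 * \<phi> x)"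
    have S: "S \<le> 1" by (simp add: S_def)
    have "r * S \<le> r * 1" by (rule mult_left_mono) (use r S in auto)
    then have q: "1 - (b + r * S) \<ge> 0" using r by argo
    have "0 \<le> r * ((1 - S) * (1 - (b + r * S)))"
      using q S r by (intro mult_nonneg_nonneg) auto
    also have "\<dots> = (1 + r) * (1 - (b + r * S)) - (1 - b) + r * (S * (b + r * S))"
      by (simp add: algebra_simps)
    finally have "0 \<le> (1 + r) * (1 - (b + r * S)) - (1 - b) + r * (S * (b + r * S))" .
    moreover have "(?F has_real_derivative (1 + r) * (1 - (b + r * S)) - (1 - b) + r * (S * (b + r * S))) (at x)"
      by (rule derivative_eq_intros d x refl)+ (auto simp: S_def field_simps)
    ultimately show "\<exists>y. (?F has_real_derivative y) (at x) \<and> 0 \<le> y" by blast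
  qed
  then have 1: "(1 + r) * J \<ge> (1 - b) * s - r * ((cos (\<theta> - 2 * \<phi> s) - cos \<theta>) / 2)"
    using assms by (simp add: J_def algebra_simps diff_divide_distrib)
  have "(cos (\<theta> - 2 * \<phi> s) - cos \<theta>) / 2 = sin (\<theta> - \<phi> s) * sin (\<phi> s)"
    using cos_diff_cos[of "\<theta> - 2 * \<phi> s" \<theta>] by (simp add: diff_divide_distrib)
  also have "\<dots> \<le> \<bar>sin (\<theta> - \<phi> s) * sin (\<phi> s)\<bar>" by simp
  also have "\<dots> \<le> 1 * \<bar>sin (\<phi> s)\<bar>" unfolding abs_mult by (rule mult_right_mono) auto
  also have "sin (\<phi> s) = sin s * cos J - cos s * sin J"
    by (simp add: J_def flip: sin_diff)
  also have "1 * \<bar>sin s * cos J - cos s * sin J\<bar> \<le> \<bar>sin s\<bar> * \<bar>cos J\<bar> + \<bar>cos s\<bar> * \<bar>sin J\<bar>"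
    using abs_triangle_ineq4[of "sin s * cos J" "cos s * sin J"] by (simp add: abs_mult)
  also have "\<dots> \<le> \<bar>sin s\<bar> * 1 + 1 * \<bar>J\<bar>"
    by (intro add_mono mult_mono) (auto simp: abs_sin_x_le_abs_x)
  also have "\<dots> = sin s + J" using s J0 by (simp add: sin_ge_zero)
  finally have "r * ((cos (\<theta> - 2 * \<phi> s) - cos \<theta>) / 2) \<le> r * (sin s + J)"
    by (rule mult_left_mono) (use r in auto)
  with 1 have "(1 + r) * J \<ge> (1 - b) * s - r * (sin s + J)" by linarith
  then have 2: "(1 + 2 * r) * J \<ge> (1 - b) * s - r * sin s" by (simp add: algebra_simps)
  \<comment> \<open>The bounds \<open>r \<le> 1 - b\<close> and \<open>r \<le> 1\<close> remove
    \<open>r\<close>; the latter turns \<open>1 + 2 * r\<close> into the constant 3.\<close>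
  have "r * sin s \<le> (1 - b) * sin s" using r s by (intro mult_right_mono) (auto simp: sin_ge_zero)
  moreover have "r * J \<le> 1 * J" using r J0 by (intro mult_right_mono) auto
  ultimately have "3 * J \<ge> (1 - b) * (s - sin s)" using 2 by (simp add: algebra_simps)
  then show ?thesis by (simp add: J_def)
qed

text \<open>\<open>R\<close> and \<open>D\<close> come from integrating \<open>x' / x\<close>, so
  \<open>D\<close> is the accumulated turn and not merely an argument modulo \<open>2 * pi\<close>.
  The upper bounds on \<open>D\<close> and \<open>- D\<close> use the lag estimate; the lower ones
  use only the pointwise speed.\<close>

lemma flow_angle:
  fixes x :: "real \<Rightarrow> complex" and P Q :: complex
  assumes deriv: "\<And>t. (x has_vector_derivative P * x t + Q * cnj (x t)) (at t)"
    and nz: "\<And>t. x t \<noteq> 0"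
    and PQ: "cmod P + cmod Q \<le> 1" and s: "0 \<le> s" "s \<le> pi"
  obtains R D where "x s = exp (Complex R D) * x 0" "\<bar>R\<bar> \<le> s"
    "D \<le> s - (1 - Im P) * (s - sin s) / 3" "- D \<le> s - (1 + Im P) * (s - sin s) / 3"
    "s - 2 * (1 - Im P) * s \<le> D" "s - 2 * (1 + Im P) * s \<le> - D"
proof -
  define g where "g = (\<lambda>t. P + Q * cnj (x t) / x t)"
  have "continuous_on UNIV x"
    using deriv by (intro continuous_at_imp_continuous_on ballI has_vector_derivative_continuous) blast
  \<comment> \<open>The interval exceeds \<open>{0..s}\<close> on both sides so that the integral
    has two-sided derivatives at the endpoints.\<close>
  then have cont: "continuous_on {-1..s+1} g"
    unfolding g_def using nz by (intro continuous_intros) (auto intro: continuous_on_subset)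
  define I where "I = (\<lambda>t. integral {-1..t} g - integral {-1..0} g)"
  have I: "(I has_vector_derivative g t) (at t)" if "0 \<le> t" "t \<le> s" for t
  proof -
    have "((\<lambda>t. integral {-1..t} g) has_vector_derivative g t) (at t within {-1..s+1})"
      using that by (intro integral_has_vector_derivative[OF cont]) auto
    then have "((\<lambda>t. integral {-1..t} g) has_vector_derivative g t) (at t)"
      using that by (subst (asm) at_within_interior) auto
    then show ?thesis
      unfolding I_def by (auto intro!: derivative_eq_intros)
  qed
  have I0: "I 0 = 0" by (simp add: I_def)
  have xI: "x t = exp (I t) * x 0" if t: "0 \<le> t" "t \<le> s" for t
  proof -
    have "((\<lambda>t. exp (- I t) * x t) has_vector_derivative 0) (at t within {0..s})" if "t \<in> {0..s}" for t
    proof -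
      have "((\<lambda>t. exp (- I t)) has_vector_derivative (- g t) * exp (- I t)) (at t)"
        using that by (intro field_vector_diff_chain_at[of _ _ _ exp, unfolded o_def])
          (auto intro!: derivative_eq_intros I)
      then have "((\<lambda>t. exp (- I t) * x t) has_vector_derivative
          exp (- I t) * (P * x t + Q * cnj (x t)) + (- g t) * exp (- I t) * x t) (at t)"
        by (intro has_vector_derivative_mult deriv)
      moreover have "exp (- I t) * (P * x t + Q * cnj (x t)) + (- g t) * exp (- I t) * x t = 0"
        using nz[of t] by (simp add: g_def field_simps)
      ultimately show ?thesis by (simp add: has_vector_derivative_at_within)
    qed
    then obtain c where c: "\<And>t. t \<in> {0..s} \<Longrightarrow> exp (- I t) * x t = c"
      by (rule has_vector_derivative_zero_constant[of "{0..s}", rotated]) auto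
    have "exp (- I t) * x t = x 0" using c[of t] c[of 0] t by (simp add: I0)
    then show ?thesis by (simp add: exp_minus field_simps)
  qed
  \<comment> \<open>The phase of \<open>Q cnj x / x\<close> at time 0; afterwards it decreases by
    twice the accumulated turn.\<close>
  define r \<theta> where "r = cmod Q" and "\<theta> = Arg (Q * (cnj (x 0) / x 0))"
  have g_eq: "g t = P + of_real r * exp (\<i> * of_real (\<theta> - 2 * Im (I t)))" if "0 \<le> t" "t \<le> s" for t
  proof -
    have "Q * (cnj (x 0) / x 0) = rcis r \<theta>"
      using nz[of 0] rcis_cmod_Arg[of "Q * (cnj (x 0) / x 0)"] by (simp add: r_def \<theta>_def norm_mult norm_divide)
    then have "Q * (cnj (x 0) / x 0) = of_real r * exp (\<i> * of_real \<theta>)"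
      by (simp add: rcis_def cis_conv_exp)
    moreover have "cnj (x t) / x t = (cnj (x 0) / x 0) * (exp (cnj (I t)) / exp (I t))"
      using xI[OF that] by (simp add: exp_cnj mult.commute)
    moreover have "exp (cnj (I t)) / exp (I t) = exp (- (\<i> * of_real (2 * Im (I t))))"
      by (subst exp_diff[symmetric], rule arg_cong[of _ _ exp]) (simp add: complex_eq_iff)
    ultimately have "Q * (cnj (x t) / x t) = of_real r * (exp (\<i> * of_real \<theta>) * exp (- (\<i> * of_real (2 * Im (I t)))))"
      by (metis mult.assoc)
    also have "exp (\<i> * of_real \<theta>) * exp (- (\<i> * of_real (2 * Im (I t)))) = exp (\<i> * of_real (\<theta> - 2 * Im (I t)))"
      by (simp add: exp_add[symmetric] algebra_simps)
    finally show ?thesis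
      by (simp add: g_def)
  qed
  define b where "b = Im P"
  define \<phi> where "\<phi> = (\<lambda>t. Im (I t))"
  have Img: "Im (g t) = b + r * sin (\<theta> - 2 * \<phi> t)" and Reg: "Re (g t) = Re P + r * cos (\<theta> - 2 * \<phi> t)"
    if "0 \<le> t" "t \<le> s" for t
    unfolding g_eq[OF that] by (simp_all add: b_def \<phi>_def Im_exp Re_exp)
  have \<phi>: "(\<phi> has_real_derivative b + r * sin (\<theta> - 2 * \<phi> t)) (at t)" if "0 \<le> t" "t \<le> s" for t
    using bounded_linear.has_vector_derivative[OF bounded_linear_Im I[OF that]]
    by (simp add: \<phi>_def has_real_derivative_iff_has_vector_derivative Img[OF that, unfolded \<phi>_def])
  have ReI: "((\<lambda>t. Re (I t)) has_real_derivative Re P + r * cos (\<theta> - 2 * \<phi> t)) (at t)" if "0 \<le> t" "t \<le> s" for t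
    using bounded_linear.has_vector_derivative[OF bounded_linear_Re I[OF that]]
    by (simp add: has_real_derivative_iff_has_vector_derivative Reg[OF that])
  have r: "0 \<le> r" "\<bar>b\<bar> + r \<le> 1" "\<bar>Re P\<bar> + r \<le> 1"
    using PQ abs_Im_le_cmod[of P] abs_Re_le_cmod[of P] by (auto simp: r_def b_def)
  have rb: "b + r \<le> 1" "- b + r \<le> 1" "Re P + r \<le> 1" "- Re P + r \<le> 1" using r by auto
  have "\<bar>r * sin y\<bar> \<le> r" "\<bar>r * cos y\<bar> \<le> r" for y
    using r(1) by (simp_all add: abs_mult mult_left_le)
  then have sc: "r * sin y \<le> r" "- r \<le> r * sin y" "r * cos y \<le> r" "- r \<le> r * cos y" for y
    by (simp_all add: abs_le_iff minus_le_iff)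
  have up: "\<phi> s \<le> s - (1 - b) * (s - sin s) / 3"
    by (rule scalar_angle_bound[OF \<phi> _ s r(1,2)]) (simp_all add: \<phi>_def I0)
  \<comment> \<open>Reflection: \<open>- \<phi>\<close> solves the same equation with
    \<open>b\<close> and \<open>\<theta>\<close> negated.\<close>
  have "((\<lambda>t. - \<phi> t) has_real_derivative - b + r * sin (- \<theta> - 2 * (- \<phi> t))) (at t)"
    if "0 \<le> t" "t \<le> s" for t
    using DERIV_minus[OF \<phi>[OF that]] sin_minus[of "\<theta> - 2 * \<phi> t"] by simp
  from scalar_angle_bound[OF this _ s r(1)] have down: "- \<phi> s \<le> s - (1 + b) * (s - sin s) / 3"
    using r(2) by (simp add: \<phi>_def I0)
  have mono: "k * s \<le> f s" if "f 0 = 0" "\<And>t. 0 \<le> t \<Longrightarrow> t \<le> s \<Longrightarrow> (f has_real_derivative f' t) (at t)"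
     "\<And>t. k \<le> f' t" for f f' :: "real \<Rightarrow> real" and k
  proof -
    have "(\<lambda>t. f t - k * t) 0 \<le> (\<lambda>t. f t - k * t) s"
    proof (rule DERIV_nonneg_imp_nondecreasing[OF s(1)])
      fix t assume t: "0 \<le> t" "t \<le> s"
      show "\<exists>y. ((\<lambda>t. f t - k * t) has_real_derivative y) (at t) \<and> 0 \<le> y"
        using that(3)[of t] by (intro exI[of _ "f' t - k"]) (auto intro!: derivative_eq_intros that(2) t)
    qed
    then show ?thesis using that(1) by simp
  qed
  \<comment> \<open>The speed is at least \<open>b - r\<close>, and
    \<open>r \<le> 1 - b\<close>.\<close>
  have "(1 - 2 * (1 - b)) * s \<le> \<phi> s"
  proof (rule mono[OF _ \<phi>])
    show "1 - 2 * (1 - b) \<le> b + r * sin (\<theta> - 2 * \<phi> t)" for t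
      using sc[of "\<theta> - 2 * \<phi> t"] rb by argo
  qed (simp_all add: \<phi>_def I0)
  then have lo1: "s - 2 * (1 - b) * s \<le> \<phi> s" by (simp add: algebra_simps)
  have "(1 - 2 * (1 + b)) * s \<le> - \<phi> s"
  proof (rule mono[OF _ DERIV_minus[OF \<phi>]])
    show "1 - 2 * (1 + b) \<le> - (b + r * sin (\<theta> - 2 * \<phi> t))" for t
      using sc[of "\<theta> - 2 * \<phi> t"] rb by argo
  qed (simp_all add: \<phi>_def I0)
  then have lo2: "s - 2 * (1 + b) * s \<le> - \<phi> s" by (simp add: algebra_simps)
  have "(-1) * s \<le> Re (I s)"
  proof (rule mono[OF _ ReI])
    show "-1 \<le> Re P + r * cos (\<theta> - 2 * \<phi> t)" for t
      using sc[of "\<theta> - 2 * \<phi> t"] rb by argo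
  qed (simp_all add: I0)
  moreover have "(-1) * s \<le> - Re (I s)"
  proof (rule mono[OF _ DERIV_minus[OF ReI]])
    show "-1 \<le> - (Re P + r * cos (\<theta> - 2 * \<phi> t))" for t
      using sc[of "\<theta> - 2 * \<phi> t"] rb by argo
  qed (simp_all add: I0)
  ultimately have "\<bar>Re (I s)\<bar> \<le> s" by linarith
  moreover have "x s = exp (Complex (Re (I s)) (\<phi> s)) * x 0"
    using xI[of s] s by (simp add: \<phi>_def)
  ultimately show thesis
    using that up down lo1 lo2 unfolding b_def by blast
qed

lemma mexp_angle:
  fixes v :: complex
  assumes A: "opnorm2 A \<le> 1" and s: "0 \<le> s" "s \<le> pi" and v: "v \<noteq> 0"
  obtains R D where
    "hol (mexp (s *\<^sub>R A)) * v + anti (mexp (s *\<^sub>R A)) * cnj v = exp (Complex R D) * v" "\<bar>R\<bar> \<le> s"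
    "D \<le> s - (1 - Im (hol A)) * (s - sin s) / 3" "- D \<le> s - (1 + Im (hol A)) * (s - sin s) / 3"
    "s - 2 * (1 - Im (hol A)) * s \<le> D" "s - 2 * (1 + Im (hol A)) * s \<le> - D"
proof -
  define P Q l b c where "P = hol A" and "Q = anti A" and "l = Re P" and "b = Im P" and "c = disc A"
  define x where "x = (\<lambda>t. hol (mexp (t *\<^sub>R A)) * v + anti (mexp (t *\<^sub>R A)) * cnj v)"
  \<comment> \<open>The image of \<open>v\<close> under \<open>dev A\<close>.\<close>
  define w where "w = \<i> * b * v + Q * cnj v"
  have x_eq: "x t = exp (t * l) *\<^sub>R (Cf c t *\<^sub>R v + Sf c t *\<^sub>R w)" for t
    unfolding x_def hol_mexp anti_mexp
    by (simp add: w_def P_def Q_def l_def b_def c_def scaleR_conv_of_real algebra_simps)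
  have c_eq: "of_real c = Q * cnj Q - of_real b ^ 2"
    unfolding c_def disc_def of_real_diff complex_norm_square by (simp add: Q_def b_def P_def)
  have x_nz: "x t \<noteq> 0" for t
  proof
    assume "x t = 0"
    then have 0: "Cf c t *\<^sub>R v + Sf c t *\<^sub>R w = 0" by (simp add: x_eq)
    \<comment> \<open>Applying the adjugate, \<open>Cf - Sf dev A\<close>, to the image recovers
      \<open>v\<close> times the determinant, which is 1.\<close>
    have "((Cf c t)\<^sup>2 - c * (Sf c t)\<^sup>2) *\<^sub>R v =
        (of_real (Cf c t) - of_real (Sf c t) * \<i> * b) * (Cf c t *\<^sub>R v + Sf c t *\<^sub>R w)
        - of_real (Sf c t) * Q * cnj (Cf c t *\<^sub>R v + Sf c t *\<^sub>R w)"
      by (simp add: scaleR_conv_of_real c_eq w_def power2_eq_square algebra_simps)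
    then show False using v by (simp only: 0 Cf_Sf_pythagoras) simp
  qed
  have x_deriv: "(x has_vector_derivative P * x t + Q * cnj (x t)) (at t)" for t
  proof -
    have e: "((\<lambda>t. exp (t * l)) has_vector_derivative exp (t * l) * l) (at t)"
      by (auto intro!: derivative_eq_intros simp flip: has_real_derivative_iff_has_vector_derivative)
    have "(x has_vector_derivative exp (t * l) *\<^sub>R ((c * Sf c t) *\<^sub>R v + Cf c t *\<^sub>R w)
        + (exp (t * l) * l) *\<^sub>R (Cf c t *\<^sub>R v + Sf c t *\<^sub>R w)) (at t)"
      unfolding x_eq[abs_def]
      by (auto intro!: derivative_eq_intros e Cf_deriv Sf_deriv)
    moreover have "exp (t * l) *\<^sub>R ((c * Sf c t) *\<^sub>R v + Cf c t *\<^sub>R w)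
        + (exp (t * l) * l) *\<^sub>R (Cf c t *\<^sub>R v + Sf c t *\<^sub>R w) = P * x t + Q * cnj (x t)"
    proof -
      have P: "P = of_real l + \<i> * of_real b" by (simp add: l_def b_def complex_eq_iff)
      show ?thesis
        unfolding x_eq P
        by (simp add: scaleR_conv_of_real c_eq w_def power2_eq_square algebra_simps)
    qed
    ultimately show ?thesis by simp
  qed
  have PQ: "cmod P + cmod Q \<le> 1" using A by (simp add: opnorm2_eq P_def Q_def)
  have x0: "x 0 = v" by (simp add: x_eq)
  from flow_angle[OF x_deriv x_nz PQ s] that show thesis
    unfolding x0 unfolding x_def P_def by blast
qed

text \<open>Bounds the deficits \<open>s - sin s\<close> and \<open>t - sin t\<close> of both
  factors below by their value at the shortest admissible time.\<close>

lemma sub_sin_mono: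
  fixes x y :: real
  assumes "x \<le> y"
  shows "x - sin x \<le> y - sin y"
proof -
  have "(\<lambda>x. x - sin x) x \<le> (\<lambda>x. x - sin x) y"
  proof (rule DERIV_nonneg_imp_nondecreasing[OF assms(1)])
    fix z :: real
    show "\<exists>d. ((\<lambda>x. x - sin x) has_real_derivative d) (at z) \<and> 0 \<le> d"
      by (intro exI[of _ "1 - cos z"]) (auto intro!: derivative_eq_intros)
  qed
  then show ?thesis by simp
qed

text \<open>Vanishes, for matrices of norm at most 1, exactly at the two exceptional pairs.\<close>

definition gap :: "mat2 \<Rightarrow> mat2 \<Rightarrow> real" where
  "gap A B = min (2 - Im (hol A) - Im (hol B)) (2 + Im (hol A) + Im (hol B))"

lemma abs_Im_hol_le:
  assumes "opnorm2 A \<le> 1"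
  shows "\<bar>Im (hol A)\<bar> \<le> 1"
  using assms abs_Im_le_cmod[of "hol A"] norm_ge_zero[of "anti A"] unfolding opnorm2_eq by linarith

text \<open>The imaginary part of \<open>hol A\<close> already uses up the whole norm, leaving
  nothing for its real part or for \<open>anti A\<close>.\<close>

lemma eq_Itilde:
  assumes "opnorm2 A \<le> 1" "Im (hol A) = 1"
  shows "A = Itilde"
proof -
  have 1: "cmod (anti A) = 0" "cmod (hol A) = 1"
    using assms abs_Im_le_cmod[of "hol A"] norm_ge_zero[of "anti A"] unfolding opnorm2_eq by linarith+
  then have "(cmod (hol A))\<^sup>2 = 1" by simp
  then have "Re (hol A) = 0" using assms by (simp add: cmod_power2)
  then show ?thesis
    using assms 1 by (intro mat2_eqI) (auto simp: hol_Itilde anti_Itilde complex_eq_iff)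
qed

lemma eq_minus_Itilde:
  assumes "opnorm2 A \<le> 1" "Im (hol A) = -1"
  shows "A = - Itilde"
proof -
  have "- A = Itilde"
    using assms by (intro eq_Itilde) (simp_all add: opnorm2_eq hol_minus anti_minus)
  then show ?thesis by (metis minus_minus)
qed

lemma gap_pos:
  assumes "opnorm2 A \<le> 1" "opnorm2 B \<le> 1" "(A, B) \<notin> {(Itilde, Itilde), (- Itilde, - Itilde)}"
  shows "gap A B > 0"
proof (rule ccontr)
  assume "\<not> ?thesis"
  then have "(Im (hol A) = 1 \<and> Im (hol B) = 1) \<or> (Im (hol A) = -1 \<and> Im (hol B) = -1)"
    using abs_Im_hol_le[OF assms(1)] abs_Im_hol_le[OF assms(2)] unfolding gap_def by linarith
  then show False
    using assms eq_Itilde eq_minus_Itilde by blast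
qed

section \<open>Products of two exponentials\<close>

text \<open>The factor with \<open>B\<close> turns \<open>v\<close>, the one with \<open>A\<close>
  turns the image, and the two turns add up. Both times are at least
  \<open>(pi - \<bar>\<alpha>0\<bar>) / 2\<close>, hence one constant \<open>\<kappa>\<close> for
  both deficits.\<close>

lemma prod_angle:
  assumes \<alpha>: "\<bar>\<alpha>\<bar> \<le> \<bar>\<alpha>0\<bar>" "\<bar>\<alpha>0\<bar> < pi" and A: "opnorm2 A \<le> 1" and B: "opnorm2 B \<le> 1"
    and v: "v \<noteq> 0" and \<kappa>: "\<kappa> = ((pi - \<bar>\<alpha>0\<bar>) / 2 - sin ((pi - \<bar>\<alpha>0\<bar>) / 2)) / 3"
  obtains R D where
    "hol (prodmat \<alpha> A B) * v + anti (prodmat \<alpha> A B) * cnj v = exp (Complex R D) * v"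
    "\<bar>R\<bar> \<le> pi" "\<bar>D\<bar> \<le> pi - \<kappa> * gap A B" "\<bar>sin D\<bar> \<le> 2 * pi * gap A B"
proof -
  define s t where "s = (pi - \<alpha>) / 2" and "t = (pi + \<alpha>) / 2"
  have st: "0 \<le> s" "s \<le> pi" "0 \<le> t" "t \<le> pi" "s + t = pi"
    "(pi - \<bar>\<alpha>0\<bar>) / 2 \<le> s" "(pi - \<bar>\<alpha>0\<bar>) / 2 \<le> t"
    using \<alpha> by (auto simp: s_def t_def field_simps)
  have \<kappa>s: "3 * \<kappa> \<le> s - sin s" and \<kappa>t: "3 * \<kappa> \<le> t - sin t"
    using sub_sin_mono[OF st(6)] sub_sin_mono[OF st(7)] \<kappa> by auto
  define E F where "E = mexp (s *\<^sub>R A)" and "F = mexp (t *\<^sub>R B)"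
  define a b where "a = Im (hol A)" and "b = Im (hol B)"
  have ab: "\<bar>a\<bar> \<le> 1" "\<bar>b\<bar> \<le> 1" using abs_Im_hol_le A B by (auto simp: a_def b_def)
  obtain R2 D2 where 2: "hol F * v + anti F * cnj v = exp (Complex R2 D2) * v" "\<bar>R2\<bar> \<le> t"
    "D2 \<le> t - (1 - b) * (t - sin t) / 3" "- D2 \<le> t - (1 + b) * (t - sin t) / 3"
    "t - 2 * (1 - b) * t \<le> D2" "t - 2 * (1 + b) * t \<le> - D2"
    unfolding F_def b_def by (rule mexp_angle[OF B st(3,4) v])
  define w where "w = exp (Complex R2 D2) * v"
  have "w \<noteq> 0" using v by (simp add: w_def)
  then obtain R1 D1 where 1: "hol E * w + anti E * cnj w = exp (Complex R1 D1) * w" "\<bar>R1\<bar> \<le> s"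
    "D1 \<le> s - (1 - a) * (s - sin s) / 3" "- D1 \<le> s - (1 + a) * (s - sin s) / 3"
    "s - 2 * (1 - a) * s \<le> D1" "s - 2 * (1 + a) * s \<le> - D1"
    unfolding E_def a_def by (rule mexp_angle[OF A st(1,2)])
  define D where "D = D1 + D2"
  have "hol (prodmat \<alpha> A B) * v + anti (prodmat \<alpha> A B) * cnj v = hol E * w + anti E * cnj w"
    unfolding w_def 2(1)[symmetric]
    by (simp add: prodmat_def hol_mult anti_mult E_def F_def s_def t_def algebra_simps)
  also have "\<dots> = exp (Complex (R1 + R2) D) * v"
  proof -
    have "Complex (R1 + R2) D = Complex R1 D1 + Complex R2 D2" by (simp add: complex_eq_iff D_def)
    then show ?thesis unfolding 1(1) by (simp add: w_def exp_add)
  qed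
  finally have main: "hol (prodmat \<alpha> A B) * v + anti (prodmat \<alpha> A B) * cnj v = exp (Complex (R1 + R2) D) * v" .
  have R: "\<bar>R1 + R2\<bar> \<le> pi" using 1(2) 2(2) st(5) by linarith
  have g: "gap A B \<le> (1 - a) + (1 - b)" "gap A B \<le> (1 + a) + (1 + b)"
    by (auto simp: gap_def a_def b_def)
  have "sin ((pi - \<bar>\<alpha>0\<bar>) / 2) \<le> (pi - \<bar>\<alpha>0\<bar>) / 2"
    using \<alpha> by (intro sin_x_le_x) auto
  then have \<kappa>0: "\<kappa> \<ge> 0" unfolding \<kappa> by simp
  have m: "(1 - a) * (3 * \<kappa>) \<le> (1 - a) * (s - sin s)" "(1 + a) * (3 * \<kappa>) \<le> (1 + a) * (s - sin s)"
    "(1 - b) * (3 * \<kappa>) \<le> (1 - b) * (t - sin t)" "(1 + b) * (3 * \<kappa>) \<le> (1 + b) * (t - sin t)"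
    using ab by (auto intro!: mult_left_mono \<kappa>s \<kappa>t)
  have add: "x + y \<le> pi - (k + l) / 3"
    if "k \<le> k'" "l \<le> l'" "x \<le> s - k' / 3" "y \<le> t - l' / 3" for x y k l k' l'
    using that st(5) by argo
  have "D \<le> pi - (((1 - a) + (1 - b)) * \<kappa>)"
    using add[OF m(1) m(3) 1(3) 2(3)] by (simp add: D_def field_simps)
  also have "\<dots> \<le> pi - gap A B * \<kappa>"
    using mult_right_mono[OF g(1) \<kappa>0] by linarith
  finally have D1: "D \<le> pi - \<kappa> * gap A B" by (simp add: mult.commute)
  have "- D \<le> pi - (((1 + a) + (1 + b)) * \<kappa>)"
    using add[OF m(2) m(4) 1(4) 2(4)] by (simp add: D_def field_simps)
  also have "\<dots> \<le> pi - gap A B * \<kappa>"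
    using mult_right_mono[OF g(2) \<kappa>0] by linarith
  finally have D2: "- D \<le> pi - \<kappa> * gap A B" by (simp add: mult.commute)
  have gap0: "gap A B \<ge> 0" using ab by (auto simp: gap_def a_def b_def)
  then have Dpi: "\<bar>D\<bar> \<le> pi" using D1 D2 mult_nonneg_nonneg[OF \<kappa>0 gap0] by linarith
  have m': "(1 - a) * s \<le> (1 - a) * pi" "(1 + a) * s \<le> (1 + a) * pi"
    "(1 - b) * t \<le> (1 - b) * pi" "(1 + b) * t \<le> (1 + b) * pi"
    using ab st by (auto intro!: mult_left_mono)
  \<comment> \<open>Here \<open>pi - D = (s - D1) + (t - D2)\<close>, and each summand is controlled
    by the pointwise speed bounds.\<close>
  have "\<bar>sin D\<bar> = \<bar>sin (pi - D)\<bar>" by simp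
  also have "\<dots> \<le> \<bar>pi - D\<bar>" by (rule abs_sin_x_le_abs_x)
  also have "\<dots> \<le> 2 * pi * ((1 - a) + (1 - b))"
    using m' 1(5) 2(5) st(5) Dpi unfolding D_def by (simp add: algebra_simps)
  finally have S1: "\<bar>sin D\<bar> \<le> 2 * pi * ((1 - a) + (1 - b))" .
  have "\<bar>sin D\<bar> = \<bar>sin (pi + D)\<bar>" by simp
  also have "\<dots> \<le> \<bar>pi + D\<bar>" by (rule abs_sin_x_le_abs_x)
  also have "\<dots> \<le> 2 * pi * ((1 + a) + (1 + b))"
    using m' 1(6) 2(6) st(5) Dpi unfolding D_def by (simp add: algebra_simps)
  finally have S2: "\<bar>sin D\<bar> \<le> 2 * pi * ((1 + a) + (1 + b))" .
  have "\<bar>sin D\<bar> \<le> 2 * pi * gap A B"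
    using S1 S2 unfolding gap_def a_def b_def by (simp add: min_def algebra_simps)
  with main R D1 D2 show thesis by (intro that) auto
qed

section \<open>From turning angles to a bounded logarithm\<close>

lemma abs_sin_ge_near_pi:
  fixes D :: real
  assumes "cos D < 0" "\<bar>D\<bar> \<le> pi - e" "0 \<le> e"
  shows "e / 2 \<le> \<bar>sin D\<bar>"
proof -
  have "pi / 2 < \<bar>D\<bar>"
    using assms(1) cos_ge_zero[of "\<bar>D\<bar>"] by (force simp: not_le[symmetric])
  then have "(pi - \<bar>D\<bar>) / 2 \<le> sin (pi - \<bar>D\<bar>)"
    using assms by (intro half_le_sin) auto
  also have "\<dots> \<le> \<bar>sin D\<bar>" by (auto simp: abs_if)
  finally show ?thesis using assms by argo
qed

text \<open>Isolates what is needed of the product: \<open>e\<close> is the margin by which turns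
  stay away from \<open>pi\<close>, \<open>u\<close> bounds the sines of the turns. The resulting
  norm bound depends on them only through \<open>u / e\<close>.\<close>

locale angle_control =
  fixes M :: mat2 and e u :: real
  assumes det: "exp (- 2 * pi) \<le> det M" "det M \<le> exp (2 * pi)" and e: "0 < e" and u: "0 < u"
    and angle: "v \<noteq> 0 \<Longrightarrow> \<exists>R D. hol M * v + anti M * cnj v = exp (Complex R D) * v \<and>
      \<bar>R\<bar> \<le> pi \<and> \<bar>D\<bar> \<le> pi - e \<and> \<bar>sin D\<bar> \<le> u"
begin

lemma det_pos: "det M > 0"
  using det exp_gt_zero[of "- 2 * pi"] by linarith

text \<open>On \<open>v\<close> the matrix acts as multiplication by
  \<open>hol M + anti M * (cnj v / v)\<close>. As \<open>cnj v / v\<close> runs through the unit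
  circle, the angle bounds hold on the whole circle with centre \<open>hol M\<close> and radius
  \<open>cmod (anti M)\<close>.\<close>

lemma angle_add:
  assumes "cmod q = cmod (anti M)"
  obtains R D where "hol M + q = exp (Complex R D)" "\<bar>R\<bar> \<le> pi" "\<bar>D\<bar> \<le> pi - e" "\<bar>sin D\<bar> \<le> u"
proof -
  define \<theta> where "\<theta> = Arg q - Arg (anti M)"
  define v where "v = cis (- \<theta> / 2)"
  have "anti M * cis \<theta> = rcis (cmod (anti M)) (Arg (anti M)) * cis \<theta>" by (simp add: rcis_cmod_Arg)
  also have "\<dots> = rcis (cmod q) (Arg q)" by (simp add: rcis_def cis_mult \<theta>_def assms)
  finally have q: "anti M * cis \<theta> = q" by (simp add: rcis_cmod_Arg)
  have "cnj v = cis \<theta> * v" by (simp add: v_def cis_cnj cis_mult)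
  then have "hol M * v + anti M * cnj v = (hol M + q) * v" by (simp add: ring_distribs flip: q)
  moreover have "v \<noteq> 0" by (simp add: v_def)
  ultimately show thesis using angle[of v] that by auto
qed

text \<open>Otherwise both eigenvalues are real and negative, and an eigenvector would be turned by
  an odd multiple of \<open>pi\<close>, although every turn is less than \<open>pi\<close>.\<close>

lemma trace_bound: "Re (hol M) / sqrt (det M) > -1"
proof (rule ccontr)
  assume "\<not> ?thesis"
  then have le: "Re (hol M) \<le> - sqrt (det M)" using det_pos by (simp add: field_simps)
  then have "(sqrt (det M))\<^sup>2 \<le> (Re (hol M))\<^sup>2"
    using det_pos by (intro abs_le_square_iff[THEN iffD1]) auto
  then have disc: "disc M \<ge> 0" using det_pos by (simp add: disc_eq)
  \<comment> \<open>Makes \<open>hol M + q\<close> equal to the smaller eigenvalue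
    \<open>Re (hol M) - sqrt (disc M)\<close>.\<close>
  define q where "q = Complex (- sqrt (disc M)) (- Im (hol M))"
  have "cmod q = cmod (anti M)"
    using disc by (simp add: q_def cmod_def[of "Complex _ _"]) (simp add: disc_def)
  then obtain R D where RD: "hol M + q = exp (Complex R D)" "\<bar>D\<bar> \<le> pi - e"
    by (rule angle_add)
  from arg_cong[OF RD(1), of Im] have "sin D = 0" by (simp add: q_def Im_exp)
  then have "D = 0"
    using RD(2) e sin_gt_zero[of D] sin_gt_zero[of "-D"] by (cases "D > 0"; cases "D < 0") auto
  moreover from arg_cong[OF RD(1), of Re] have "Re (hol M) - sqrt (disc M) = exp R * cos D"
    by (simp add: q_def Re_exp)
  moreover have "Re (hol M) < 0" using le det_pos by (smt (verit) real_sqrt_gt_zero)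
  moreover have "exp R > 0" "sqrt (disc M) \<ge> 0" using disc by simp_all
  ultimately show False by simp
qed

text \<open>Takes the points of the circle straight above and below its centre; up to sign their
  imaginary parts are \<open>i + r\<close> and \<open>i - r\<close>. When the centre lies in the
  left half plane, the turn is obtuse, so the margin \<open>e\<close> bounds its sine from
  below.\<close>

lemma Im_add_bounds:
  defines "i \<equiv> \<bar>Im (hol M)\<bar>" and "r \<equiv> cmod (anti M)"
  shows "i + r \<le> exp pi" "i + r \<le> exp pi * u"
    "Re (hol M) < 0 \<Longrightarrow> exp (- pi) * (e / 2) \<le> \<bar>i - r\<bar>"
proof -
  define \<sigma> :: real where "\<sigma> = (if Im (hol M) < 0 then -1 else 1)"
  have \<sigma>: "Im (hol M) = \<sigma> * i" "\<bar>\<sigma>\<bar> = 1" by (auto simp: \<sigma>_def i_def)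
  have "cmod (Complex 0 (\<sigma> * r)) = cmod (anti M)" using \<sigma> by (simp add: cmod_def r_def power_mult_distrib \<sigma>_def)
  then obtain R D where RD: "hol M + Complex 0 (\<sigma> * r) = exp (Complex R D)" "\<bar>R\<bar> \<le> pi" "\<bar>sin D\<bar> \<le> u"
    by (rule angle_add)
  have "\<sigma> * (i + r) = exp R * sin D"
    using arg_cong[OF RD(1), of Im] by (simp add: Im_exp \<sigma> ring_distribs)
  then have "\<bar>\<sigma>\<bar> * \<bar>i + r\<bar> = exp R * \<bar>sin D\<bar>" by (metis abs_mult abs_exp_cancel)
  then have ir: "i + r = exp R * \<bar>sin D\<bar>" using \<sigma>(2) by (simp add: i_def r_def)
  have R: "exp R \<le> exp pi" using RD(2) by simp
  have "exp R * \<bar>sin D\<bar> \<le> exp pi * 1" by (intro mult_mono R) auto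
  then show "i + r \<le> exp pi" using ir by simp
  have "exp R * \<bar>sin D\<bar> \<le> exp pi * u" by (intro mult_mono R RD) auto
  then show "i + r \<le> exp pi * u" using ir by simp
  assume neg: "Re (hol M) < 0"
  have "cmod (Complex 0 (- \<sigma> * r)) = cmod (anti M)" using \<sigma> by (simp add: cmod_def r_def power_mult_distrib \<sigma>_def)
  then obtain R D where RD: "hol M + Complex 0 (- \<sigma> * r) = exp (Complex R D)" "\<bar>R\<bar> \<le> pi" "\<bar>D\<bar> \<le> pi - e"
    by (rule angle_add)
  have "\<sigma> * (i - r) = exp R * sin D"
    using arg_cong[OF RD(1), of Im] by (simp add: Im_exp \<sigma> ring_distribs)
  then have "\<bar>\<sigma>\<bar> * \<bar>i - r\<bar> = exp R * \<bar>sin D\<bar>" by (metis abs_mult abs_exp_cancel)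
  then have ir: "\<bar>i - r\<bar> = exp R * \<bar>sin D\<bar>" using \<sigma>(2) by simp
  have "exp R * cos D < 0"
    using arg_cong[OF RD(1), of Re] neg by (simp add: Re_exp)
  then have "cos D < 0" by (simp add: mult_less_0_iff)
  then have "e / 2 \<le> \<bar>sin D\<bar>" using RD(3) e by (intro abs_sin_ge_near_pi) auto
  moreover have "exp (- pi) \<le> exp R" using RD(2) by simp
  ultimately have "exp (- pi) * (e / 2) \<le> exp R * \<bar>sin D\<bar>" using e by (intro mult_mono) auto
  then show "exp (- pi) * (e / 2) \<le> \<bar>i - r\<bar>" using ir by simp
qed

text \<open>Only the factor \<open>AC x / d\<close> can be large, and only for \<open>x\<close> near
  \<open>-1\<close>. There it is at most \<open>pi / sqrt ((i - r) * (i + r))\<close>, so the norm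
  is governed by the ratio of \<open>i + r\<close> to \<open>i - r\<close>.\<close>

lemma opnorm2_mlog_le:
  "opnorm2 (mlog M) \<le> pi + 2 * exp (2 * pi) + pi * sqrt (2 * exp (2 * pi) * (u / e))"
proof -
  define d where "d = sqrt (det M)"
  define x where "x = Re (hol M) / d"
  define k where "k = AC x / d"
  define i r where "i = \<bar>Im (hol M)\<bar>" and "r = cmod (anti M)"
  have d: "d > 0" "d\<^sup>2 = det M" using det_pos by (simp_all add: d_def)
  have x: "x > -1" using trace_bound by (simp add: x_def d_def)
  have k: "k > 0" using AC_pos[OF x] d by (simp add: k_def)
  have ir: "0 \<le> i" "0 \<le> r" by (simp_all add: i_def r_def)
  note B = Im_add_bounds[folded i_def r_def]
  have "ln (exp (- 2 * pi)) \<le> ln (det M)" "ln (det M) \<le> ln (exp (2 * pi))"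
    using det det_pos by (subst ln_le_cancel_iff; simp)+
  then have ln: "\<bar>ln (det M) / 2\<bar> \<le> pi" by simp
  have "opnorm2 (mlog M) = cmod (Complex (ln (det M) / 2) (k * Im (hol M))) + k * r"
    using mlog_eq[OF det_pos trace_bound] AC_pos[OF x] d
    by (simp add: opnorm2_eq nlog_def norm_mult norm_divide k_def x_def d_def r_def)
  also have "cmod (Complex (ln (det M) / 2) (k * Im (hol M))) \<le> \<bar>ln (det M) / 2\<bar> + k * i"
    using cmod_le[of "Complex (ln (det M) / 2) (k * Im (hol M))"] k by (simp add: abs_mult i_def)
  finally have 1: "opnorm2 (mlog M) \<le> pi + k * (i + r)"
    using ln by (simp add: ring_distribs)
  have pos: "0 \<le> 2 * exp (2 * pi)" "0 \<le> pi * sqrt (2 * exp (2 * pi) * (u / e))"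
    using e u by (auto intro!: mult_nonneg_nonneg)
  show ?thesis
  proof (cases "x \<ge> 0")
    case True
    have "exp (- pi) \<le> d"
      unfolding d_def using det(1) by (intro real_le_rsqrt) (simp add: exp_double[symmetric])
    then have "AC x / d \<le> 2 / exp (- pi)"
      using AC_le_2[OF True] by (intro frac_le) auto
    then have "k \<le> 2 * exp pi" by (simp add: k_def exp_minus divide_inverse)
    then have "k * (i + r) \<le> 2 * exp pi * exp pi"
      using B(1) ir by (intro mult_mono) auto
    also have "\<dots> = 2 * exp (2 * pi)" by (simp add: exp_double power2_eq_square)
    finally show ?thesis using 1 pos by linarith
  next
    case False
    then have neg: "Re (hol M) < 0" using d by (simp add: x_def divide_less_0_iff not_le)
    have "x\<^sup>2 < 1" using x False by (simp add: abs_square_less_1)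
    have "det M * (1 - x\<^sup>2) = - disc M"
      using det_pos by (simp add: x_def power_divide right_diff_distrib d(2) disc_eq)
    also have "\<dots> = (i - r) * (i + r)"
      by (simp add: disc_def i_def r_def power2_eq_square algebra_simps)
    finally have "det M * (1 - x\<^sup>2) = (i - r) * (i + r)" .
    moreover have "det M * (1 - x\<^sup>2) > 0" using \<open>x\<^sup>2 < 1\<close> det_pos by simp
    ultimately have p: "(i - r) * (i + r) > 0" and dx: "d * sqrt (1 - x\<^sup>2) = sqrt ((i - r) * (i + r))"
      by (simp, simp add: d_def flip: real_sqrt_mult)
    then have ir': "i - r > 0" "i + r > 0" using ir by (auto simp: zero_less_mult_iff)
    \<comment> \<open>The quotient of the upper bound \<open>exp pi * u\<close> on
      \<open>i + r\<close> by the lower bound \<open>exp (- pi) * (e / 2)\<close> on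
      \<open>i - r\<close>.\<close>
    define K where "K = 2 * exp (2 * pi) * (u / e)"
    have "i + r \<le> exp pi * u" by (rule B(2))
    also have "\<dots> = K * (exp (- pi) * (e / 2))"
      unfolding K_def exp_double using e by (simp add: exp_minus power2_eq_square field_simps)
    also have "\<dots> \<le> K * (i - r)"
      using B(3)[OF neg] ir' e u by (intro mult_left_mono) (auto simp: K_def)
    finally have "i + r \<le> K * (i - r)" .
    then have "(i + r) * (i + r) \<le> K * (i - r) * (i + r)"
      using ir' by (intro mult_right_mono) auto
    then have "i + r \<le> sqrt (K * ((i - r) * (i + r)))"
      by (intro real_le_rsqrt) (simp add: power2_eq_square mult_ac)
    then have 2: "(i + r) / sqrt ((i - r) * (i + r)) \<le> sqrt K"
      using p unfolding real_sqrt_mult[of K] by (subst pos_divide_le_eq) auto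
    have "k * (i + r) \<le> pi / sqrt (1 - x\<^sup>2) / d * (i + r)"
      unfolding k_def using AC_le_pi[of x] x False d ir' by (intro mult_right_mono divide_right_mono) auto
    also have "\<dots> = pi * ((i + r) / sqrt ((i - r) * (i + r)))"
      unfolding dx[symmetric] by simp
    also have "\<dots> \<le> pi * sqrt K" by (intro mult_left_mono 2) simp
    finally show ?thesis using 1 pos unfolding K_def by linarith
  qed
qed

end

section \<open>Application to the products and the extremal example\<close>

lemma prodmat_angle_control:
  assumes \<alpha>0: "\<bar>\<alpha>0\<bar> < pi" and mem: "(\<alpha>, A, B) \<in> prodset \<alpha>0"
    and \<kappa>: "\<kappa> = ((pi - \<bar>\<alpha>0\<bar>) / 2 - sin ((pi - \<bar>\<alpha>0\<bar>) / 2)) / 3"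
  shows "angle_control (prodmat \<alpha> A B) (\<kappa> * gap A B) (2 * pi * gap A B)"
proof
  have \<alpha>: "\<bar>\<alpha>\<bar> \<le> \<bar>\<alpha>0\<bar>" and A: "opnorm2 A \<le> 1" and B: "opnorm2 B \<le> 1"
    and AB: "(A, B) \<notin> {(Itilde, Itilde), (- Itilde, - Itilde)}"
    using mem by (auto simp: prodset_def)
  define s t where "s = (pi - \<alpha>) / 2" and "t = (pi + \<alpha>) / 2"
  have st: "0 \<le> s" "0 \<le> t" "s + t = pi"
    using \<alpha> \<alpha>0 by (auto simp: s_def t_def field_simps)
  \<comment> \<open>Half the logarithm of the determinant of the product, a combination of the half
    traces with total weight \<open>pi\<close>.\<close>
  define y where "y = s * Re (hol A) + t * Re (hol B)"
  have "\<bar>Re (hol A)\<bar> \<le> 1" "\<bar>Re (hol B)\<bar> \<le> 1"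
    using A B abs_Re_le_cmod[of "hol A"] abs_Re_le_cmod[of "hol B"] norm_ge_zero[of "anti A"] norm_ge_zero[of "anti B"]
    unfolding opnorm2_eq by linarith+
  then have "\<bar>s * Re (hol A)\<bar> \<le> s" "\<bar>t * Re (hol B)\<bar> \<le> t"
    using st by (auto simp: abs_mult intro: mult_left_le)
  then have y: "\<bar>y\<bar> \<le> pi" using st(3) unfolding y_def by linarith
  have "det (prodmat \<alpha> A B) = exp (2 * y)"
    by (simp add: prodmat_def det_mul det_mexp flip: s_def t_def)
       (simp add: y_def exp_add exp_double power_mult_distrib)
  then show "exp (- 2 * pi) \<le> det (prodmat \<alpha> A B)" "det (prodmat \<alpha> A B) \<le> exp (2 * pi)"
    using y by auto
  have gap: "gap A B > 0" by (rule gap_pos[OF A B AB])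
  have "sin ((pi - \<bar>\<alpha>0\<bar>) / 2) < (pi - \<bar>\<alpha>0\<bar>) / 2"
    using \<alpha>0 by (intro sin_less_self) auto
  then have "\<kappa> > 0" unfolding \<kappa> by simp
  then show "0 < \<kappa> * gap A B" "0 < 2 * pi * gap A B" using gap by simp_all
  show "\<exists>R D. hol (prodmat \<alpha> A B) * v + anti (prodmat \<alpha> A B) * cnj v = exp (Complex R D) * v \<and>
      \<bar>R\<bar> \<le> pi \<and> \<bar>D\<bar> \<le> pi - \<kappa> * gap A B \<and> \<bar>sin D\<bar> \<le> 2 * pi * gap A B" if "v \<noteq> 0" for v
    by (rule prod_angle[OF \<alpha> \<alpha>0 A B that \<kappa>]) blast
qed

text \<open>The product of the stretch and the rotation has coordinates
  \<open>cosh q * cis p\<close> and \<open>sinh q * cis (- p)\<close> and determinant 1, so its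
  logarithm is trace-free and the two moduli add up to \<open>G p\<close>.\<close>

lemma G_attained:
  assumes "\<bar>\<alpha>0\<bar> < pi" and p: "p = (pi + \<bar>\<alpha>0\<bar>) / 2"
  obtains A B where "(\<bar>\<alpha>0\<bar>, A, B) \<in> prodset \<alpha>0" "opnorm2 (mlog (prodmat \<bar>\<alpha>0\<bar> A B)) = G p"
proof -
  define A where "A = ofc 0 1"
  define M where "M = prodmat \<bar>\<alpha>0\<bar> A Itilde"
  have A: "hol A = 0" "anti A = 1" by (simp_all add: A_def)
  then have "A \<noteq> Itilde" "A \<noteq> - Itilde"
    by (auto simp: hol_Itilde hol_minus)
  then have mem: "(\<bar>\<alpha>0\<bar>, A, Itilde) \<in> prodset \<alpha>0"
    by (simp add: prodset_def opnorm2_eq A hol_Itilde anti_Itilde)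
  define q where "q = pi - p"
  have q: "(pi - \<bar>\<alpha>0\<bar>) / 2 = q" "(pi + \<bar>\<alpha>0\<bar>) / 2 = p" using p by (simp_all add: q_def field_simps)
  have q0: "q \<ge> 0" "0 \<le> p" "p \<le> pi" using assms by (auto simp: q_def field_simps)
  have disc: "disc A = 1" "disc Itilde = -1"
    by (simp_all add: disc_def A hol_Itilde anti_Itilde)
  have M: "hol M = of_real (cosh q) * cis p" "anti M = of_real (sinh q) * cis (- p)"
    unfolding M_def prodmat_def hol_mult anti_mult hol_mexp anti_mexp q disc
    by (simp_all add: A hol_Itilde anti_Itilde Cf_def Sf_def complex_eq_iff)
  have det1: "det M = 1"
    by (simp add: det_hol_anti M norm_mult cosh_square_eq)
  interpret angle_control M "((pi - \<bar>\<alpha>0\<bar>) / 2 - sin ((pi - \<bar>\<alpha>0\<bar>) / 2)) / 3 * gap A Itilde"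
      "2 * pi * gap A Itilde"
    unfolding M_def by (rule prodmat_angle_control[OF assms(1) mem refl])
  define x where "x = cosh q * cos p"
  have x: "x > -1" using trace_bound by (simp add: det1 M x_def)
  have s: "sin p \<ge> 0" using q0 by (intro sin_ge_zero) auto
  have "opnorm2 (mlog M) = cmod (Complex 0 (AC x * (cosh q * sin p))) + AC x * sinh q"
    using mlog_eq[OF det_pos trace_bound] AC_pos[OF x] q0
    by (simp add: opnorm2_eq nlog_def det1 norm_mult M x_def)
  also have "cmod (Complex 0 (AC x * (cosh q * sin p))) = AC x * (cosh q * sin p)"
    using AC_pos[OF x] s by (simp add: cmod_def abs_mult)
  also have "\<dots> + AC x * sinh q = G p"
    by (simp add: G_def x_def q_def algebra_simps)
  finally show thesis using that[OF mem] by (simp add: M_def)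
qed

theorem theorem6p2:
  fixes \<alpha>0 p :: real
  assumes "- pi < \<alpha>0" and "\<alpha>0 < pi"
    and "p = (pi + \<bar>\<alpha>0\<bar>) / 2"
  shows "(\<forall>(\<alpha>, A, B) \<in> prodset \<alpha>0. log_welldef (prodmat \<alpha> A B))
    \<and> bdd_above ((\<lambda>(\<alpha>, A, B). opnorm2 (mlog (prodmat \<alpha> A B))) ` prodset \<alpha>0)
    \<and> G p \<le> (SUP (\<alpha>, A, B) \<in> prodset \<alpha>0. opnorm2 (mlog (prodmat \<alpha> A B)))"
proof (intro conjI)
  have \<alpha>0: "\<bar>\<alpha>0\<bar> < pi" using assms by auto
  define \<kappa> where "\<kappa> = ((pi - \<bar>\<alpha>0\<bar>) / 2 - sin ((pi - \<bar>\<alpha>0\<bar>) / 2)) / 3"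
  note control = prodmat_angle_control[OF \<alpha>0 _ \<kappa>_def]
  show "\<forall>(\<alpha>, A, B) \<in> prodset \<alpha>0. log_welldef (prodmat \<alpha> A B)"
    using log_welldefI angle_control.det_pos[OF control] angle_control.trace_bound[OF control] by fast
  \<comment> \<open>Margin and sine bound are both proportional to \<open>gap A B\<close>, so their
    ratio is \<open>2 * pi / \<kappa>\<close> for every pair, however close to the exceptional
    ones.\<close>
  define K where "K = pi + 2 * exp (2 * pi) + pi * sqrt (2 * exp (2 * pi) * (2 * pi / \<kappa>))"
  have "opnorm2 (mlog (prodmat \<alpha> A B)) \<le> K" if mem: "(\<alpha>, A, B) \<in> prodset \<alpha>0" for \<alpha> A B
  proof -
    have "gap A B \<noteq> 0" using angle_control.u[OF control[OF mem]] by auto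
    then show ?thesis
      using angle_control.opnorm2_mlog_le[OF control[OF mem]] by (simp add: K_def)
  qed
  then show bdd: "bdd_above ((\<lambda>(\<alpha>, A, B). opnorm2 (mlog (prodmat \<alpha> A B))) ` prodset \<alpha>0)"
    by (intro bdd_aboveI[of _ K]) auto
  obtain A B where "(\<bar>\<alpha>0\<bar>, A, B) \<in> prodset \<alpha>0" "opnorm2 (mlog (prodmat \<bar>\<alpha>0\<bar> A B)) = G p"
    by (rule G_attained[OF \<alpha>0 assms(3)])
  then show "G p \<le> (SUP (\<alpha>, A, B) \<in> prodset \<alpha>0. opnorm2 (mlog (prodmat \<alpha> A B)))"
    using cSUP_upper[OF _ bdd, of "(\<bar>\<alpha>0\<bar>, A, B)"] by simp
qed

end
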